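(* Let $\mathbb{H}$ and $\mathbb{K}$ be complex Hilbert spaces, and let $A$ be a bounded linear operator on $\mathbb{H}$ and $B$ a bounded linear operator on $\mathbb{K}$. Then $$w^2(A \otimes B) \geq \frac{\|A^*A \otimes B^*B+AA^* \otimes BB^*\|}{4} + \frac{\Big|\,\|A \otimes B+iA^* \otimes B^*\|^2-\|A \otimes B-iA^* \otimes B^*\|^2\,\Big|}{8}.$$
   Context: For a bounded linear operator $T$ on a complex Hilbert space with inner product $\langle\cdot,\cdot\rangle$, the numerical radius is $w(T)=\sup\{|\langle Tx,x\rangle| : \|x\|=1\}$, $w^2(T)$ denotes $(w(T))^2$, and $\|T\|$ is the operator norm. Here $i$ is the imaginary unit. $\mathbb{H}\otimes\mathbb{K}$ is the Hilbert space tensor product (the completion of the algebraic tensor product under the inner product determined by $\langle x\otimes y,z\otimes u\rangle=\langle x,z\rangle\langle y,u\rangle$), and $A\otimes B$ is the bounded linear operator on $\mathbb{H}\otimes\mathbb{K}$ determined by $(A\otimes B)(x\otimes y)=Ax\otimes By$. *)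

theory Defs
  imports "HOL-Analysis.Analysis"
begin

section \<open>Complex Hilbert spaces\<close>

text \<open>
  The inner product is linear in its first argument. Norm and topology are those of the
  underlying real inner product space, so \<open>norm x = sqrt (Re (cinner x x))\<close>.
\<close>

class complex_inner = real_inner +
  fixes scaleC :: "complex \<Rightarrow> 'a \<Rightarrow> 'a"  (infixr \<open>*\<^sub>C\<close> 75)
    and cinner :: "'a \<Rightarrow> 'a \<Rightarrow> complex"
  assumes scaleC_add_right: "c *\<^sub>C (x + y) = c *\<^sub>C x + c *\<^sub>C y"
    and scaleC_add_left: "(c + d) *\<^sub>C x = c *\<^sub>C x + d *\<^sub>C x"
    and scaleC_scaleC: "c *\<^sub>C d *\<^sub>C x = (c * d) *\<^sub>C x"
    and scaleR_scaleC: "r *\<^sub>R x = complex_of_real r *\<^sub>C x"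
    and cinner_commute: "cinner x y = cnj (cinner y x)"
    and cinner_add_left: "cinner (x + y) z = cinner x z + cinner y z"
    and cinner_scaleC_left: "cinner (c *\<^sub>C x) y = c * cinner x y"
    and inner_eq_Re_cinner: "inner x y = Re (cinner x y)"

class chilbert_space = complex_inner + complete_space

instantiation complex :: chilbert_space
begin

definition scaleC_complex :: "complex \<Rightarrow> complex \<Rightarrow> complex" where "scaleC_complex = (*)"
definition cinner_complex :: "complex \<Rightarrow> complex \<Rightarrow> complex" where "cinner_complex x y = x * cnj y"

instance
  by standard (simp_all add: scaleC_complex_def cinner_complex_def inner_complex_def
      scaleR_conv_of_real algebra_simps)

end

lemma scaleC_one: "1 *\<^sub>C x = x" for x :: "'a::complex_inner"
  using scaleR_scaleC[of 1 x] by simp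

lemma scaleC_zero_left: "0 *\<^sub>C x = 0" for x :: "'a::complex_inner"
  using scaleR_scaleC[of 0 x] by simp

lemma scaleC_minus1: "(- 1) *\<^sub>C x = - x" for x :: "'a::complex_inner"
  using scaleR_scaleC[of "-1" x] by simp

lemma scaleC_zero_right: "c *\<^sub>C 0 = (0 :: 'a::complex_inner)"
  using scaleC_add_right[of c 0 "0::'a"] by simp

lemma scaleC_minus_right: "c *\<^sub>C (- x) = - (c *\<^sub>C x)" for x :: "'a::complex_inner"
  by (metis scaleC_minus1 scaleC_scaleC mult.commute)

lemma scaleC_diff_right: "c *\<^sub>C (x - y) = c *\<^sub>C x - c *\<^sub>C y" for x :: "'a::complex_inner"
  by (metis diff_conv_add_uminus scaleC_add_right scaleC_minus_right)

lemma cinner_zero_left: "cinner 0 y = 0" for y :: "'a::complex_inner"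
  using cinner_add_left[of 0 0 y] by simp

lemma cinner_zero_right: "cinner y 0 = 0" for y :: "'a::complex_inner"
  by (metis cinner_commute cinner_zero_left complex_cnj_zero)

lemma cinner_add_right: "cinner x (y + z) = cinner x y + cinner x z" for x :: "'a::complex_inner"
  by (metis cinner_add_left cinner_commute complex_cnj_add)

lemma cinner_scaleC_right: "cinner x (c *\<^sub>C y) = cnj c * cinner x y" for x :: "'a::complex_inner"
  by (metis cinner_scaleC_left cinner_commute complex_cnj_mult)

lemma cinner_minus_left: "cinner (- x) y = - cinner x y" for x :: "'a::complex_inner"
  by (metis cinner_scaleC_left scaleC_minus1 mult_minus1)

lemma cinner_diff_left: "cinner (x - y) z = cinner x z - cinner y z" for x :: "'a::complex_inner"
  by (metis cinner_add_left cinner_minus_left diff_conv_add_uminus)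

lemma cinner_diff_right: "cinner z (x - y) = cinner z x - cinner z y" for x :: "'a::complex_inner"
  by (metis cinner_diff_left cinner_commute complex_cnj_diff)

lemma cinner_self: "cinner x x = complex_of_real ((norm x)\<^sup>2)" for x :: "'a::complex_inner"
proof -
  have "Im (cinner x x) = 0"
    using cinner_commute[of x x] by (metis Reals_cnj_iff complex_is_Real_iff)
  moreover have "Re (cinner x x) = (norm x)\<^sup>2"
    by (simp add: norm_eq_sqrt_inner flip: inner_eq_Re_cinner)
  ultimately show ?thesis by (simp add: complex_eq_iff)
qed

lemma norm_scaleC: "norm (c *\<^sub>C x) = cmod c * norm x" for x :: "'a::complex_inner"
proof -
  have "complex_of_real ((norm (c *\<^sub>C x))\<^sup>2) = (c * cnj c) * complex_of_real ((norm x)\<^sup>2)"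
    unfolding cinner_self[symmetric] cinner_scaleC_left cinner_scaleC_right by simp
  also have "\<dots> = complex_of_real ((cmod c * norm x)\<^sup>2)"
    by (simp add: power_mult_distrib flip: complex_norm_square)
  finally have "complex_of_real ((norm (c *\<^sub>C x))\<^sup>2) = complex_of_real ((cmod c * norm x)\<^sup>2)" .
  then have "(norm (c *\<^sub>C x))\<^sup>2 = (cmod c * norm x)\<^sup>2"
    using of_real_eq_iff by blast
  then show ?thesis
    by (simp add: norm_eq_sqrt_inner)
qed

lemma norm_cinner_le: "cmod (cinner x y) \<le> norm x * norm y" for x y :: "'a::complex_inner"
proof (cases "cinner x y = 0")
  case False
  define c where "c = cnj (cinner x y) / cmod (cinner x y)"
  have "cmod c = 1" using False by (simp add: c_def norm_divide)
  have "c * cinner x y = complex_of_real (cmod (cinner x y))"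
    using False unfolding c_def
    by (metis complex_norm_square mult.commute nonzero_mult_div_cancel_left of_real_eq_0_iff
        of_real_power power2_eq_square times_divide_eq_right norm_eq_zero)
  then have "inner (c *\<^sub>C x) y = cmod (cinner x y)"
    by (simp add: inner_eq_Re_cinner cinner_scaleC_left)
  moreover have "inner (c *\<^sub>C x) y \<le> norm (c *\<^sub>C x) * norm y"
    by (rule norm_cauchy_schwarz)
  ultimately show ?thesis using \<open>cmod c = 1\<close> by (simp add: norm_scaleC)
qed simp

lemma bounded_bilinear_cinner: "bounded_bilinear (cinner :: 'a::complex_inner \<Rightarrow> 'a \<Rightarrow> complex)"
proof
  show "\<exists>K. \<forall>a b :: 'a. cmod (cinner a b) \<le> norm a * norm b * K"
    using norm_cinner_le by (intro exI[of _ 1]) auto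
qed (simp_all add: cinner_add_left cinner_add_right scaleR_scaleC cinner_scaleC_left
    cinner_scaleC_right scaleC_complex_def)

lemmas tendsto_cinner = bounded_bilinear.tendsto[OF bounded_bilinear_cinner]

lemma bounded_linear_scaleC: "bounded_linear (scaleC c :: 'a::complex_inner \<Rightarrow> 'a)"
  by (rule bounded_linear_intro[of _ "cmod c"])
    (simp_all add: scaleC_add_right scaleR_scaleC scaleC_scaleC norm_scaleC mult.commute)

section \<open>Bounded operators\<close>

definition bounded_clinear :: "('a::complex_inner \<Rightarrow> 'b::complex_inner) \<Rightarrow> bool" where
  "bounded_clinear T \<longleftrightarrow> bounded_linear T \<and> (\<forall>c x. T (c *\<^sub>C x) = c *\<^sub>C T x)"

definition cadjoint :: "('a::chilbert_space \<Rightarrow> 'a) \<Rightarrow> 'a \<Rightarrow> 'a"  (\<open>_\<^sup>\<dagger>\<close> [1000] 1000) where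
  "T\<^sup>\<dagger> = (THE S. \<forall>x y. cinner (T x) y = cinner x (S y))"

text \<open>
  On the zero space there are no unit vectors, so the value there is the unspecified supremum of
  the empty set of reals.
\<close>

definition numerical_radius :: "('a::complex_inner \<Rightarrow> 'a) \<Rightarrow> real" where
  "numerical_radius T = (SUP x\<in>{x. norm x = 1}. cmod (cinner (T x) x))"

section \<open>The algebraic tensor product\<close>

text \<open>
  A list of pairs stands for the formal sum of the tensors \<open>x \<otimes> y\<close> of its entries; coefficients are
  absorbed into the first components. \<open>tensor_eq\<close> is the congruence generated by bilinearity.
\<close>

inductive tensor_eq :: "('a::complex_inner \<times> 'b::complex_inner) list \<Rightarrow> ('a \<times> 'b) list \<Rightarrow> bool" where
  refl: "tensor_eq l l"
| sym: "tensor_eq l m \<Longrightarrow> tensor_eq m l"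
| trans: "tensor_eq l m \<Longrightarrow> tensor_eq m n \<Longrightarrow> tensor_eq l n"
| append: "tensor_eq l l' \<Longrightarrow> tensor_eq m m' \<Longrightarrow> tensor_eq (l @ m) (l' @ m')"
| commute: "tensor_eq (l @ m) (m @ l)"
| add_left: "tensor_eq [(x + x', y)] [(x, y), (x', y)]"
| add_right: "tensor_eq [(x, y + y')] [(x, y), (x, y')]"
| scale: "tensor_eq [(c *\<^sub>C x, y)] [(x, c *\<^sub>C y)]"
| zero: "tensor_eq [(0, y)] []"

quotient_type (overloaded) ('a, 'b) atensor = "('a::complex_inner \<times> 'b::complex_inner) list" / tensor_eq
  by (rule equivpI) (auto intro!: reflpI sympI transpI tensor_eq.refl elim: tensor_eq.sym tensor_eq.trans)

definition list_scaleC :: "complex \<Rightarrow> ('a::complex_inner \<times> 'b::complex_inner) list \<Rightarrow> ('a \<times> 'b) list" where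
  "list_scaleC c l = map (\<lambda>(x, y). (c *\<^sub>C x, y)) l"

text \<open>\<open>\<langle>x \<otimes> y, z \<otimes> u\<rangle> = \<langle>x, z\<rangle> \<langle>y, u\<rangle>\<close>, extended sesquilinearly to formal sums.\<close>

definition list_cinner :: "('a::complex_inner \<times> 'b::complex_inner) list \<Rightarrow> ('a \<times> 'b) list \<Rightarrow> complex" where
  "list_cinner l m = (\<Sum>(x, y)\<leftarrow>l. \<Sum>(z, u)\<leftarrow>m. cinner x z * cinner y u)"

lemma list_scaleC_simps [simp]:
  "list_scaleC c [] = []"
  "list_scaleC c ((x, y) # l) = (c *\<^sub>C x, y) # list_scaleC c l"
  "list_scaleC c (l @ m) = list_scaleC c l @ list_scaleC c m"
  by (simp_all add: list_scaleC_def)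

lemma list_cinner_Nil [simp]: "list_cinner [] m = 0" "list_cinner l [] = 0"
  by (simp_all add: list_cinner_def case_prod_unfold)

lemma list_cinner_single: "list_cinner [(x, y)] [(z, u)] = cinner x z * cinner y u"
  by (simp add: list_cinner_def)

lemma list_cinner_append [simp]:
  "list_cinner (l @ l') m = list_cinner l m + list_cinner l' m"
  "list_cinner l (m @ m') = list_cinner l m + list_cinner l m'"
  by (simp_all add: list_cinner_def case_prod_unfold sum_list_addf)

lemma list_cinner_Cons:
  "list_cinner (p # l) m = list_cinner [p] m + list_cinner l m"
  "list_cinner l (p # m) = list_cinner l [p] + list_cinner l m"
  using list_cinner_append(1)[of "[p]" l m] list_cinner_append(2)[of l "[p]" m] by simp_all

lemma list_cinner_commute: "list_cinner l m = cnj (list_cinner m l)"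
proof (induction l)
  case (Cons p l)
  have "list_cinner [p] m = cnj (list_cinner m [p])"
  proof (induction m)
    case (Cons q m)
    have "list_cinner [p] [q] = cnj (list_cinner [q] [p])"
      by (cases p, cases q) (simp add: list_cinner_single flip: cinner_commute)
    with Cons show ?case
      by (simp add: list_cinner_Cons(1)[of q m] list_cinner_Cons(2)[of "[p]" q m])
  qed simp
  with Cons show ?case
    by (simp add: list_cinner_Cons(1)[of p l] list_cinner_Cons(2)[of m p l])
qed simp

lemma list_cinner_scaleC: "list_cinner (list_scaleC c l) m = c * list_cinner l m"
  by (simp add: list_cinner_def list_scaleC_def case_prod_unfold o_def cinner_scaleC_left
      sum_list_const_mult mult.assoc)

lemma list_cinner_cong_left:
  assumes "tensor_eq l l'" shows "list_cinner l m = list_cinner l' m"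
  using assms
proof (induction)
  case (scale c x y)
  show ?case
    by (simp add: list_cinner_def case_prod_unfold cinner_scaleC_left mult_ac)
qed (simp_all add: list_cinner_def case_prod_unfold cinner_add_left cinner_zero_left
    distrib_left distrib_right sum_list_addf)

lemma list_cinner_cong:
  assumes "tensor_eq l l'" "tensor_eq m m'" shows "list_cinner l m = list_cinner l' m'"
  using list_cinner_cong_left[OF assms(1)] list_cinner_cong_left[OF assms(2)]
  by (metis list_cinner_commute)

lemma tensor_eq_scaleC:
  assumes "tensor_eq l l'" shows "tensor_eq (list_scaleC c l) (list_scaleC c l')"
  using assms
proof (induction)
  case (scale d x y)
  then show ?case
    using tensor_eq.scale[of d "c *\<^sub>C x" y]
    by (simp add: scaleC_scaleC mult.commute)
next
  case (trans l m n)
  show ?case by (rule tensor_eq.trans[OF trans.IH])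
next
  case (sym l m)
  show ?case by (rule tensor_eq.sym[OF sym.IH])
qed (simp_all add: scaleC_add_right scaleC_zero_right tensor_eq.refl tensor_eq.append
    tensor_eq.commute tensor_eq.add_left tensor_eq.add_right tensor_eq.zero)

lemma tensor_eq_Cons: "tensor_eq l l' \<Longrightarrow> tensor_eq (p # l) (p # l')"
  using tensor_eq.append[OF tensor_eq.refl[of "[p]"], of l l'] by simp

lemma tensor_eq_move: "tensor_eq (p # q # l) (q # p # l)"
  using tensor_eq.append[OF tensor_eq.commute[of "[p]" "[q]"] tensor_eq.refl[of l]] by simp

lemma tensor_eq_Cons_cong2: "tensor_eq [p] [q, r] \<Longrightarrow> tensor_eq (p # l) (q # r # l)"
  using tensor_eq.append[OF _ tensor_eq.refl[of l], of "[p]" "[q, r]"] by simp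

lemma tensor_eq_Cons_cong0: "tensor_eq [p] [] \<Longrightarrow> tensor_eq (p # l) l"
  using tensor_eq.append[OF _ tensor_eq.refl[of l], of "[p]" "[]"] by simp

lemma tensor_eq_zero_right: "tensor_eq [(x, 0)] []"
  using tensor_eq.trans[OF tensor_eq.sym[OF tensor_eq.scale[of 0 x 0]], of "[]"]
  by (simp add: scaleC_zero_left tensor_eq.zero)

lemma tensor_eq_neg: "tensor_eq (list_scaleC (- 1) l @ l) []"
proof (induction l)
  case Nil
  then show ?case by (simp add: tensor_eq.refl)
next
  case (Cons p l)
  obtain x y where p: "p = (x, y)" by (cases p)
  have "tensor_eq [(- x, y), (x, y)] []"
    using tensor_eq.trans[OF tensor_eq.sym[OF tensor_eq.add_left[of "- x" x y]], of "[]"]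
    by (simp add: tensor_eq.zero)
  from tensor_eq.append[OF this Cons]
  have a: "tensor_eq ([(- x, y), (x, y)] @ (list_scaleC (- 1) l @ l)) []"
    by simp
  have "tensor_eq ((list_scaleC (- 1) l @ [(x, y)]) @ l) (([(x, y)] @ list_scaleC (- 1) l) @ l)"
    by (intro tensor_eq.append tensor_eq.commute tensor_eq.refl)
  then have "tensor_eq ((- x, y) # list_scaleC (- 1) l @ (x, y) # l)
      ((- x, y) # (x, y) # list_scaleC (- 1) l @ l)"
    by (intro tensor_eq_Cons) simp
  from tensor_eq.trans[OF this] a show ?case
    by (simp add: p scaleC_minus1)
qed

lemma tensor_eq_list_scaleC_add: "tensor_eq (list_scaleC (c + d) l) (list_scaleC c l @ list_scaleC d l)"
proof (induction l)
  case Nil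
  then show ?case by (simp add: tensor_eq.refl)
next
  case (Cons p l)
  obtain x y where p: "p = (x, y)" by (cases p)
  have "tensor_eq ([((c + d) *\<^sub>C x, y)] @ list_scaleC (c + d) l)
     ([(c *\<^sub>C x, y), (d *\<^sub>C x, y)] @ (list_scaleC c l @ list_scaleC d l))"
    unfolding scaleC_add_left by (intro tensor_eq.append tensor_eq.add_left Cons)
  moreover have "tensor_eq ([(c *\<^sub>C x, y)] @ (([(d *\<^sub>C x, y)] @ list_scaleC c l) @ list_scaleC d l))
     ([(c *\<^sub>C x, y)] @ ((list_scaleC c l @ [(d *\<^sub>C x, y)]) @ list_scaleC d l))"
    by (intro tensor_eq.append tensor_eq.commute tensor_eq.refl)
  ultimately show ?case
    using tensor_eq.trans[of "[((c + d) *\<^sub>C x, y)] @ list_scaleC (c + d) l"] by (simp add: p)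
qed

text \<open>
  Positivity: by Gram--Schmidt every formal sum is equivalent to one whose second components
  are pairwise orthogonal.
\<close>

lemma tensor_eq_split:
  assumes "y = y' + (\<Sum>p\<leftarrow>m. a p *\<^sub>C snd p)"
  shows "tensor_eq ((x, y) # m) ((x, y') # map (\<lambda>p. (fst p + a p *\<^sub>C x, snd p)) m)"
  using assms
proof (induction m arbitrary: y)
  case Nil
  then show ?case by (simp add: tensor_eq.refl)
next
  case (Cons p m)
  define z where "z = y' + (\<Sum>p\<leftarrow>m. a p *\<^sub>C snd p)"
  obtain u v where p: "p = (u, v)" by (cases p)
  have y: "y = z + a p *\<^sub>C v" using Cons(2) by (simp add: z_def p add_ac)
  have 1: "tensor_eq ((x, y) # p # m) ((x, z) # (x, a p *\<^sub>C v) # p # m)"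
    unfolding y by (rule tensor_eq_Cons_cong2[OF tensor_eq.add_right])
  have "tensor_eq [(u + a p *\<^sub>C x, v)] [(a p *\<^sub>C x, v), (u, v)]"
    by (subst add.commute) (rule tensor_eq.add_left)
  moreover have "tensor_eq ([(a p *\<^sub>C x, v)] @ [(u, v)]) ([(x, a p *\<^sub>C v)] @ [(u, v)])"
    by (intro tensor_eq.append tensor_eq.scale tensor_eq.refl)
  ultimately have "tensor_eq [(u + a p *\<^sub>C x, v)] [(x, a p *\<^sub>C v), (u, v)]"
    using tensor_eq.trans[of "[(u + a p *\<^sub>C x, v)]"] by simp
  from tensor_eq.sym[OF tensor_eq_Cons_cong2[OF this]]
  have 2: "tensor_eq ((x, z) # (x, a p *\<^sub>C v) # p # m) ((x, z) # (u + a p *\<^sub>C x, v) # m)"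
    unfolding p by (rule tensor_eq_Cons)
  have 3: "tensor_eq ((x, z) # (u + a p *\<^sub>C x, v) # m) ((u + a p *\<^sub>C x, v) # (x, z) # m)"
    by (rule tensor_eq_move)
  have 4: "tensor_eq ((u + a p *\<^sub>C x, v) # (x, z) # m) ((u + a p *\<^sub>C x, v) # (x, y') #
      map (\<lambda>p. (fst p + a p *\<^sub>C x, snd p)) m)"
    by (intro tensor_eq_Cons Cons(1)) (simp add: z_def)
  have 5: "tensor_eq \<dots> ((x, y') # (u + a p *\<^sub>C x, v) # map (\<lambda>p. (fst p + a p *\<^sub>C x, snd p)) m)"
    by (rule tensor_eq_move)
  have "tensor_eq ((x, y) # p # m) ((x, y') # (u + a p *\<^sub>C x, v) # map (\<lambda>p. (fst p + a p *\<^sub>C x, snd p)) m)"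
    by (rule tensor_eq.trans[OF tensor_eq.trans[OF tensor_eq.trans[OF tensor_eq.trans[OF 1 2] 3] 4] 5])
  then show ?case by (simp add: p)
qed

lemma orthogonal_decomp:
  fixes ys :: "'b::complex_inner list"
  assumes "sorted_wrt (\<lambda>u v. cinner u v = 0) ys"
  shows "\<exists>a. \<forall>v\<in>set ys. cinner (y - (\<Sum>u\<leftarrow>ys. a u *\<^sub>C u)) v = 0"
proof -
  define a where "a v = cinner y v / cinner v v" for v
  have *: "cinner (\<Sum>u\<leftarrow>zs. a u *\<^sub>C u) v = 0" if "\<forall>u\<in>set zs. cinner u v = 0" for zs v
    using that by (induction zs) (auto simp: cinner_zero_left cinner_add_left cinner_scaleC_left)
  have "\<forall>v\<in>set ys. cinner (\<Sum>u\<leftarrow>ys. a u *\<^sub>C u) v = cinner y v"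
    using assms
  proof (induction ys)
    case (Cons w ys)
    have w: "cinner (a w *\<^sub>C w) w = cinner y w"
      by (cases "w = 0") (auto simp: a_def cinner_scaleC_left cinner_zero_right cinner_self)
    have "\<forall>u\<in>set ys. cinner u w = 0"
    proof
      fix u assume "u \<in> set ys"
      then show "cinner u w = 0" using Cons.prems cinner_commute[of u w] by simp
    qed
    then have "cinner (\<Sum>u\<leftarrow>ys. a u *\<^sub>C u) w = 0" by (rule *)
    moreover have "\<forall>v\<in>set ys. cinner w v = 0" using Cons.prems by simp
    ultimately show ?case
      using Cons w by (simp add: cinner_add_left cinner_scaleC_left)
  qed simp
  then show ?thesis
    by (intro exI[of _ a]) (simp add: cinner_diff_left)
qed

lemma tensor_eq_orthogonal:
  "\<exists>m. tensor_eq l m \<and> sorted_wrt (\<lambda>u v. cinner u v = 0) (map snd m)"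
proof (induction l)
  case Nil
  then show ?case by (intro exI[of _ "[]"]) (simp add: tensor_eq.refl)
next
  case (Cons p l)
  obtain x y where p: "p = (x, y)" by (cases p)
  from Cons obtain m where m: "tensor_eq l m" "sorted_wrt (\<lambda>u v. cinner u v = 0) (map snd m)"
    by blast
  obtain a where a: "\<forall>v\<in>set (map snd m). cinner (y - (\<Sum>u\<leftarrow>map snd m. a u *\<^sub>C u)) v = 0"
    using orthogonal_decomp[OF m(2)] by blast
  define y' where "y' = y - (\<Sum>u\<leftarrow>map snd m. a u *\<^sub>C u)"
  define m' where "m' = (x, y') # map (\<lambda>p. (fst p + a (snd p) *\<^sub>C x, snd p)) m"
  have "tensor_eq ((x, y) # m) m'"
    unfolding m'_def by (rule tensor_eq_split) (simp add: y'_def o_def)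
  then have "tensor_eq (p # l) m'"
    using tensor_eq.trans[OF tensor_eq_Cons[OF m(1), of p]] by (simp add: p)
  moreover have "sorted_wrt (\<lambda>u v. cinner u v = 0) (map snd m')"
    using m(2) a by (simp add: m'_def y'_def o_def)
  ultimately show ?case by (intro exI[of _ m'] conjI)
qed

lemma list_cinner_orthogonal:
  assumes "sorted_wrt (\<lambda>u v. cinner u v = 0) (map snd m)"
  shows "list_cinner m m = complex_of_real (\<Sum>(x, y)\<leftarrow>m. (norm x)\<^sup>2 * (norm y)\<^sup>2)"
  using assms
proof (induction m)
  case (Cons p m)
  obtain x y where p: "p = (x, y)" by (cases p)
  have *: "list_cinner [(x, y)] n = 0" if "\<forall>v\<in>set (map snd n). cinner y v = 0" for n
    using that
  proof (induction n)
    case (Cons q n)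
    have "list_cinner [(x, y)] [q] = 0"
      using Cons.prems by (cases q) (simp add: list_cinner_single)
    with Cons show ?case
      by (simp add: list_cinner_Cons(2)[of _ q n])
  qed simp
  have "list_cinner [p] m = 0" using Cons.prems * by (simp add: p)
  moreover from this have "list_cinner m [p] = 0"
    using list_cinner_commute[of m "[p]"] by simp
  moreover have "list_cinner (p # m) (p # m)
      = list_cinner [p] [p] + list_cinner [p] m + (list_cinner m [p] + list_cinner m m)"
    by (simp add: list_cinner_Cons(1)[of p m] list_cinner_Cons(2)[of _ p m])
  moreover have "list_cinner [p] [p] = complex_of_real ((norm x)\<^sup>2 * (norm y)\<^sup>2)"
    by (simp add: p list_cinner_single cinner_self)
  ultimately show ?case using Cons by (simp add: p)
qed simp

lemma list_cinner_nonneg: "0 \<le> Re (list_cinner l l)"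
proof -
  obtain m where m: "tensor_eq l m" "sorted_wrt (\<lambda>u v. cinner u v = 0) (map snd m)"
    using tensor_eq_orthogonal by blast
  have "list_cinner l l = list_cinner m m" by (rule list_cinner_cong[OF m(1) m(1)])
  then show ?thesis
    by (auto simp: list_cinner_orthogonal[OF m(2)] intro!: sum_list_nonneg)
qed

lemma list_cinner_definite:
  assumes "Re (list_cinner l l) = 0" shows "tensor_eq l []"
proof -
  obtain m where m: "tensor_eq l m" "sorted_wrt (\<lambda>u v. cinner u v = 0) (map snd m)"
    using tensor_eq_orthogonal by blast
  have "list_cinner l l = list_cinner m m" by (rule list_cinner_cong[OF m(1) m(1)])
  with assms have "(\<Sum>(x, y)\<leftarrow>m. (norm x)\<^sup>2 * (norm y)\<^sup>2) = 0"
    by (simp add: list_cinner_orthogonal[OF m(2)])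
  then have "\<forall>(x, y)\<in>set m. x = 0 \<or> y = 0"
    by (subst (asm) sum_list_nonneg_eq_0_iff) auto
  then have "tensor_eq m []"
  proof (induction m)
    case Nil
    then show ?case by (simp add: tensor_eq.refl)
  next
    case (Cons p m)
    then have "tensor_eq [p] []"
      by (auto simp: tensor_eq.zero tensor_eq_zero_right)
    then show ?case
      using Cons tensor_eq.trans[OF tensor_eq_Cons_cong0[of p m]] by simp
  qed
  with m(1) show ?thesis by (rule tensor_eq.trans)
qed

instantiation atensor :: (complex_inner, complex_inner) complex_inner
begin

lift_definition zero_atensor :: "('a, 'b) atensor" is "[]" .

lift_definition plus_atensor :: "('a, 'b) atensor \<Rightarrow> ('a, 'b) atensor \<Rightarrow> ('a, 'b) atensor"
  is "(@)" by (rule tensor_eq.append)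

lift_definition scaleC_atensor :: "complex \<Rightarrow> ('a, 'b) atensor \<Rightarrow> ('a, 'b) atensor"
  is list_scaleC by (rule tensor_eq_scaleC)

lift_definition cinner_atensor :: "('a, 'b) atensor \<Rightarrow> ('a, 'b) atensor \<Rightarrow> complex"
  is list_cinner by (rule list_cinner_cong)

definition "uminus (s :: ('a, 'b) atensor) = (- 1) *\<^sub>C s"
definition "minus (s :: ('a, 'b) atensor) t = s + - t"
definition "r *\<^sub>R (s :: ('a, 'b) atensor) = complex_of_real r *\<^sub>C s"
definition "inner (s :: ('a, 'b) atensor) t = Re (cinner s t)"
definition "norm (s :: ('a, 'b) atensor) = sqrt (inner s s)"
definition "sgn (s :: ('a, 'b) atensor) = inverse (norm s) *\<^sub>R s"
definition "dist (s :: ('a, 'b) atensor) t = norm (s - t)"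
definition "(uniformity :: (('a, 'b) atensor \<times> ('a, 'b) atensor) filter) =
  (INF e\<in>{0<..}. principal {(s, t). dist s t < e})"
definition "open (U :: ('a, 'b) atensor set) \<longleftrightarrow>
  (\<forall>x\<in>U. eventually (\<lambda>(x', y). x' = x \<longrightarrow> y \<in> U) uniformity)"

instance
proof
  fix a b c :: "('a, 'b) atensor" and r q :: real and k l :: complex
  show add_assoc: "a + b + c = a + (b + c)"
    by transfer (simp add: tensor_eq.refl)
  show "a + b = b + a"
    by transfer (rule tensor_eq.commute)
  show "0 + a = a"
    by transfer (simp add: tensor_eq.refl)
  show "- a + a = 0"
    unfolding uminus_atensor_def by transfer (rule tensor_eq_neg)
  show "a - b = a + - b" by (rule minus_atensor_def)
  show right: "k *\<^sub>C (a + b) = k *\<^sub>C a + k *\<^sub>C b" for k and a b :: "('a, 'b) atensor"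
    by transfer (simp add: tensor_eq.refl)
  show left: "(k + l) *\<^sub>C a = k *\<^sub>C a + l *\<^sub>C a" for k l and a :: "('a, 'b) atensor"
    by transfer (rule tensor_eq_list_scaleC_add)
  show assoc: "k *\<^sub>C l *\<^sub>C a = (k * l) *\<^sub>C a" for k l and a :: "('a, 'b) atensor"
    by transfer (simp add: list_scaleC_def case_prod_unfold o_def scaleC_scaleC tensor_eq.refl)
  have one: "1 *\<^sub>C a = a" for a :: "('a, 'b) atensor"
    by transfer (simp add: list_scaleC_def scaleC_one tensor_eq.refl)
  show "r *\<^sub>R a = complex_of_real r *\<^sub>C a" by (rule scaleR_atensor_def)
  show "r *\<^sub>R (a + b) = r *\<^sub>R a + r *\<^sub>R b"
    by (simp add: scaleR_atensor_def right)
  show "(r + q) *\<^sub>R a = r *\<^sub>R a + q *\<^sub>R a"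
    by (simp add: scaleR_atensor_def left)
  show "r *\<^sub>R q *\<^sub>R a = (r * q) *\<^sub>R a"
    by (simp add: scaleR_atensor_def assoc)
  show "1 *\<^sub>R a = a"
    by (simp add: scaleR_atensor_def one)
  show com: "cinner a b = cnj (cinner b a)" for a b :: "('a, 'b) atensor"
    by transfer (rule list_cinner_commute)
  show cadd: "cinner (a + b) c = cinner a c + cinner b c"
    by transfer simp
  show csc: "cinner (k *\<^sub>C a) b = k * cinner a b" for k
    by transfer (rule list_cinner_scaleC)
  show "inner a b = Re (cinner a b)" by (rule inner_atensor_def)
  show "inner a b = inner b a"
    unfolding inner_atensor_def by (subst com) simp
  show "inner (a + b) c = inner a c + inner b c"
    by (simp add: inner_atensor_def cadd)
  show "inner (r *\<^sub>R a) b = r * inner a b"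
    by (simp add: inner_atensor_def scaleR_atensor_def csc)
  show "0 \<le> inner a a"
    unfolding inner_atensor_def by transfer (rule list_cinner_nonneg)
  show "inner a a = 0 \<longleftrightarrow> a = 0"
    unfolding inner_atensor_def
  proof transfer
    fix l :: "('a \<times> 'b) list"
    show "Re (list_cinner l l) = 0 \<longleftrightarrow> tensor_eq l []"
      using list_cinner_definite[of l] list_cinner_cong_left[of l "[]" l] by auto
  qed
  show "norm a = sqrt (inner a a)" by (rule norm_atensor_def)
  show "sgn a = inverse (norm a) *\<^sub>R a" by (rule sgn_atensor_def)
  show "dist a b = norm (a - b)" by (rule dist_atensor_def)
  show "(uniformity :: (('a, 'b) atensor \<times> ('a, 'b) atensor) filter) =
      (INF e\<in>{0<..}. principal {(s, t). dist s t < e})"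
    by (rule uniformity_atensor_def)
  show "open U \<longleftrightarrow> (\<forall>x\<in>U. eventually (\<lambda>(x', y). x' = x \<longrightarrow> y \<in> U) uniformity)"
    for U :: "('a, 'b) atensor set"
    by (rule open_atensor_def)
qed

end

lift_definition atensor_of :: "'a::complex_inner \<Rightarrow> 'b::complex_inner \<Rightarrow> ('a, 'b) atensor"
  is "\<lambda>x y. [(x, y)]" .

lemma atensor_of_add:
  "atensor_of (x + x') y = atensor_of x y + atensor_of x' y"
  "atensor_of x (y + y') = atensor_of x y + atensor_of x y'"
  by (transfer, simp add: tensor_eq.add_left tensor_eq.add_right)+

lemma atensor_of_scaleC:
  "atensor_of (c *\<^sub>C x) y = c *\<^sub>C atensor_of x y"
  "atensor_of x (c *\<^sub>C y) = c *\<^sub>C atensor_of x y"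
  by (transfer, simp add: tensor_eq.refl tensor_eq.sym[OF tensor_eq.scale])+

lemma atensor_sum:
  fixes t :: "('a::complex_inner, 'b::complex_inner) atensor"
  shows "\<exists>l. t = (\<Sum>(x, y)\<leftarrow>l. atensor_of x y)"
proof (induction t)
  case (1 l)
  have "abs_atensor l = (\<Sum>(x, y)\<leftarrow>l. atensor_of x y)"
  proof (induction l)
    case Nil
    show ?case by (simp add: zero_atensor_def)
  next
    case (Cons p l)
    have "abs_atensor (p # l) = atensor_of (fst p) (snd p) + abs_atensor l"
      by (simp add: atensor_of.abs_eq plus_atensor.abs_eq)
    with Cons show ?case by (simp add: case_prod_unfold)
  qed
  then show ?case by blast
qed

lemma cinner_atensor_of: "cinner (atensor_of x y) (atensor_of z u) = cinner x z * cinner y u"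
  by transfer (rule list_cinner_single)

section \<open>Completion of a complex inner product space\<close>

definition cauchy_eq :: "(nat \<Rightarrow> 'a::complex_inner) \<Rightarrow> (nat \<Rightarrow> 'a) \<Rightarrow> bool" where
  "cauchy_eq X Y \<longleftrightarrow> Cauchy X \<and> Cauchy Y \<and> (\<lambda>n. X n - Y n) \<longlonglongrightarrow> 0"

quotient_type (overloaded) 'a hcompletion = "nat \<Rightarrow> 'a::complex_inner" / partial: cauchy_eq
proof (rule part_equivpI)
  show "\<exists>X :: nat \<Rightarrow> 'a. cauchy_eq X X"
    by (rule exI[of _ "\<lambda>_. 0"]) (simp add: cauchy_eq_def convergent_const convergent_Cauchy)
  show "symp (cauchy_eq :: (nat \<Rightarrow> 'a) \<Rightarrow> _)"
  proof (rule sympI)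
    fix X Y :: "nat \<Rightarrow> 'a" assume "cauchy_eq X Y"
    then show "cauchy_eq Y X"
      using tendsto_minus[of "\<lambda>n. X n - Y n" 0 sequentially] by (simp add: cauchy_eq_def)
  qed
  show "transp (cauchy_eq :: (nat \<Rightarrow> 'a) \<Rightarrow> _)"
  proof (rule transpI)
    fix X Y Z :: "nat \<Rightarrow> 'a" assume "cauchy_eq X Y" "cauchy_eq Y Z"
    then show "cauchy_eq X Z"
      using tendsto_add[of "\<lambda>n. X n - Y n" 0 sequentially "\<lambda>n. Y n - Z n" 0]
      by (simp add: cauchy_eq_def)
  qed
qed

lemma Cauchy_cinner:
  fixes X Y :: "nat \<Rightarrow> 'a::complex_inner"
  assumes "Cauchy X" "Cauchy Y"
  shows "convergent (\<lambda>n. cinner (X n) (Y n))"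
proof -
  obtain K L where KL: "\<And>n. norm (X n) \<le> K" "\<And>n. norm (Y n) \<le> L" "K > 0" "L > 0"
    using Cauchy_Bseq[OF assms(1)] Cauchy_Bseq[OF assms(2)] unfolding Bseq_def by blast
  have "Cauchy (\<lambda>n. cinner (X n) (Y n))"
  proof (rule metric_CauchyI)
    fix e :: real assume "e > 0"
    then have e: "e / (2 * L) > 0" "e / (2 * K) > 0" using KL by simp_all
    obtain M where M: "\<And>m n. m \<ge> M \<Longrightarrow> n \<ge> M \<Longrightarrow> norm (X m - X n) < e / (2 * L)"
      using CauchyD[OF assms(1) e(1)] by blast
    obtain N where N: "\<And>m n. m \<ge> N \<Longrightarrow> n \<ge> N \<Longrightarrow> norm (Y m - Y n) < e / (2 * K)"
      using CauchyD[OF assms(2) e(2)] by blast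
    have "dist (cinner (X m) (Y m)) (cinner (X n) (Y n)) < e" if "m \<ge> max M N" "n \<ge> max M N" for m n
    proof -
      have "cinner (X m) (Y m) - cinner (X n) (Y n)
          = cinner (X m - X n) (Y m) + cinner (X n) (Y m - Y n)"
        by (simp add: cinner_diff_left cinner_diff_right)
      then have "dist (cinner (X m) (Y m)) (cinner (X n) (Y n))
          \<le> cmod (cinner (X m - X n) (Y m)) + cmod (cinner (X n) (Y m - Y n))"
        by (simp add: dist_norm norm_triangle_ineq)
      also have "\<dots> \<le> norm (X m - X n) * norm (Y m) + norm (X n) * norm (Y m - Y n)"
        by (intro add_mono norm_cinner_le)
      also have "\<dots> \<le> norm (X m - X n) * L + K * norm (Y m - Y n)"
        using KL by (intro add_mono mult_left_mono mult_right_mono) auto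
      also have "\<dots> < e / (2 * L) * L + K * (e / (2 * K))"
        using M[of m n] N[of m n] that KL by (intro add_strict_mono mult_strict_right_mono mult_strict_left_mono) auto
      also have "\<dots> = e" using KL by (simp add: field_simps)
      finally show ?thesis .
    qed
    then show "\<exists>M. \<forall>m\<ge>M. \<forall>n\<ge>M. dist (cinner (X m) (Y m)) (cinner (X n) (Y n)) < e"
      by blast
  qed
  then show ?thesis by (rule Cauchy_convergent)
qed

lemma cauchy_eq_cinner:
  assumes "cauchy_eq X X'" "cauchy_eq Y Y'"
  shows "lim (\<lambda>n. cinner (X n) (Y n)) = lim (\<lambda>n. cinner (X' n) (Y' n))"
proof -
  have C: "Cauchy X" "Cauchy X'" "Cauchy Y" "Cauchy Y'"
    and z: "(\<lambda>n. X n - X' n) \<longlonglongrightarrow> 0" "(\<lambda>n. Y n - Y' n) \<longlonglongrightarrow> 0"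
    using assms by (auto simp: cauchy_eq_def)
  have 1: "(\<lambda>n. cinner (X n - X' n) (Y n)) \<longlonglongrightarrow> 0"
    using bounded_bilinear.Zfun_prod_Bfun[OF bounded_bilinear_cinner, of "\<lambda>n. X n - X' n" sequentially Y]
      z(1) Cauchy_Bseq[OF C(3)] by (simp add: tendsto_Zfun_iff)
  have 2: "(\<lambda>n. cinner (X' n) (Y n - Y' n)) \<longlonglongrightarrow> 0"
    using bounded_bilinear.Bfun_prod_Zfun[OF bounded_bilinear_cinner, of X' sequentially "\<lambda>n. Y n - Y' n"]
      z(2) Cauchy_Bseq[OF C(2)] by (simp add: tendsto_Zfun_iff)
  have "(\<lambda>n. cinner (X' n) (Y' n)) \<longlonglongrightarrow> lim (\<lambda>n. cinner (X' n) (Y' n))"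
    using Cauchy_cinner[OF C(2,4)] by (simp add: convergent_LIMSEQ_iff)
  from tendsto_add[OF tendsto_add[OF 1 2] this]
  have "(\<lambda>n. cinner (X n) (Y n)) \<longlonglongrightarrow> lim (\<lambda>n. cinner (X' n) (Y' n))"
    by (simp add: cinner_diff_left cinner_diff_right)
  then show ?thesis by (rule limI)
qed

lemma Cauchy_scaleC: "Cauchy X \<Longrightarrow> Cauchy (\<lambda>n. c *\<^sub>C X n)" for X :: "nat \<Rightarrow> 'a::complex_inner"
  by (rule bounded_linear.Cauchy[OF bounded_linear_scaleC])

lemma Cauchy_plus: "Cauchy X \<Longrightarrow> Cauchy Y \<Longrightarrow> Cauchy (\<lambda>n. X n + Y n)"
  for X Y :: "nat \<Rightarrow> 'a::real_normed_vector"
proof (rule CauchyI)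
  fix e :: real assume XY: "Cauchy X" "Cauchy Y" and "0 < e"
  then have e: "e / 2 > 0" by simp
  obtain M where M: "\<And>m n. m \<ge> M \<Longrightarrow> n \<ge> M \<Longrightarrow> norm (X m - X n) < e / 2"
    using CauchyD[OF XY(1) e] by blast
  obtain N where N: "\<And>m n. m \<ge> N \<Longrightarrow> n \<ge> N \<Longrightarrow> norm (Y m - Y n) < e / 2"
    using CauchyD[OF XY(2) e] by blast
  have "norm (X m + Y m - (X n + Y n)) < e" if "m \<ge> max M N" "n \<ge> max M N" for m n
    using M[of m n] N[of m n] norm_triangle_ineq[of "X m - X n" "Y m - Y n"] that
    by (simp add: add_diff_add)
  then show "\<exists>M. \<forall>m\<ge>M. \<forall>n\<ge>M. norm (X m + Y m - (X n + Y n)) < e" by blast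
qed

lemma Cauchy_const: "Cauchy (\<lambda>_. x)" for x :: "'a::metric_space"
  by (simp add: convergent_const convergent_Cauchy)

instantiation hcompletion :: (complex_inner) complex_inner
begin

lift_definition zero_hcompletion :: "'a hcompletion" is "\<lambda>_. 0"
  by (simp add: cauchy_eq_def Cauchy_const)

lift_definition plus_hcompletion :: "'a hcompletion \<Rightarrow> 'a hcompletion \<Rightarrow> 'a hcompletion"
  is "\<lambda>X Y n. X n + Y n"
  by (auto simp: cauchy_eq_def add_diff_add intro: Cauchy_plus tendsto_add_zero)

lift_definition scaleC_hcompletion :: "complex \<Rightarrow> 'a hcompletion \<Rightarrow> 'a hcompletion"
  is "\<lambda>c X n. c *\<^sub>C X n"
  by (auto simp: cauchy_eq_def intro: Cauchy_scaleC
      bounded_linear.tendsto_zero[OF bounded_linear_scaleC] simp flip: scaleC_diff_right)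

lift_definition cinner_hcompletion :: "'a hcompletion \<Rightarrow> 'a hcompletion \<Rightarrow> complex"
  is "\<lambda>X Y. lim (\<lambda>n. cinner (X n) (Y n))"
  by (rule cauchy_eq_cinner)

definition "uminus (s :: 'a hcompletion) = (- 1) *\<^sub>C s"
definition "minus (s :: 'a hcompletion) t = s + - t"
definition "r *\<^sub>R (s :: 'a hcompletion) = complex_of_real r *\<^sub>C s"
definition "inner (s :: 'a hcompletion) t = Re (cinner s t)"
definition "norm (s :: 'a hcompletion) = sqrt (inner s s)"
definition "sgn (s :: 'a hcompletion) = inverse (norm s) *\<^sub>R s"
definition "dist (s :: 'a hcompletion) t = norm (s - t)"
definition "(uniformity :: ('a hcompletion \<times> 'a hcompletion) filter) =
  (INF e\<in>{0<..}. principal {(s, t). dist s t < e})"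
definition "open (U :: 'a hcompletion set) \<longleftrightarrow>
  (\<forall>x\<in>U. eventually (\<lambda>(x', y). x' = x \<longrightarrow> y \<in> U) uniformity)"

instance
proof
  have [simp]: "cauchy_eq X X \<longleftrightarrow> Cauchy X" for X :: "nat \<Rightarrow> 'a"
    by (auto simp: cauchy_eq_def)
  note lims = Cauchy_cinner[unfolded convergent_LIMSEQ_iff]
  fix a b c :: "'a hcompletion" and r q :: real and k l :: complex
  show add_assoc: "a + b + c = a + (b + c)"
    by transfer (simp add: add.assoc Cauchy_plus)
  show "a + b = b + a"
    by transfer (simp add: add.commute Cauchy_plus)
  show "0 + a = a"
    by transfer simp
  show "- a + a = 0"
    unfolding uminus_hcompletion_def
    by transfer (simp add: scaleC_minus1 Cauchy_const)
  show "a - b = a + - b" by (rule minus_hcompletion_def)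
  show right: "k *\<^sub>C (a + b) = k *\<^sub>C a + k *\<^sub>C b" for k and a b :: "'a hcompletion"
    by transfer (simp add: scaleC_add_right Cauchy_plus Cauchy_scaleC)
  show left: "(k + l) *\<^sub>C a = k *\<^sub>C a + l *\<^sub>C a" for k l and a :: "'a hcompletion"
    by transfer (simp add: scaleC_add_left Cauchy_plus Cauchy_scaleC)
  show assoc: "k *\<^sub>C l *\<^sub>C a = (k * l) *\<^sub>C a" for k l and a :: "'a hcompletion"
    by transfer (simp add: scaleC_scaleC Cauchy_scaleC)
  have one: "1 *\<^sub>C a = a" for a :: "'a hcompletion"
    by transfer (simp add: scaleC_one)
  show "r *\<^sub>R a = complex_of_real r *\<^sub>C a" by (rule scaleR_hcompletion_def)
  show "r *\<^sub>R (a + b) = r *\<^sub>R a + r *\<^sub>R b"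
    by (simp add: scaleR_hcompletion_def right)
  show "(r + q) *\<^sub>R a = r *\<^sub>R a + q *\<^sub>R a"
    by (simp add: scaleR_hcompletion_def left)
  show "r *\<^sub>R q *\<^sub>R a = (r * q) *\<^sub>R a"
    by (simp add: scaleR_hcompletion_def assoc)
  show "1 *\<^sub>R a = a"
    by (simp add: scaleR_hcompletion_def one)
  show com: "cinner a b = cnj (cinner b a)" for a b :: "'a hcompletion"
  proof transfer
    fix X Y :: "nat \<Rightarrow> 'a" assume "cauchy_eq X X" "cauchy_eq Y Y"
    then have "(\<lambda>n. cnj (cinner (Y n) (X n))) \<longlonglongrightarrow> cnj (lim (\<lambda>n. cinner (Y n) (X n)))"
      by (intro tendsto_cnj lims) simp_all
    then show "lim (\<lambda>n. cinner (X n) (Y n)) = cnj (lim (\<lambda>n. cinner (Y n) (X n)))"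
      by (intro limI) (simp flip: cinner_commute)
  qed
  show cadd: "cinner (a + b) c = cinner a c + cinner b c"
  proof transfer
    fix X Y Z :: "nat \<Rightarrow> 'a" assume "cauchy_eq X X" "cauchy_eq Y Y" "cauchy_eq Z Z"
    then show "lim (\<lambda>n. cinner (X n + Y n) (Z n))
        = lim (\<lambda>n. cinner (X n) (Z n)) + lim (\<lambda>n. cinner (Y n) (Z n))"
      unfolding cinner_add_left by (intro limI tendsto_add lims) simp_all
  qed
  show csc: "cinner (k *\<^sub>C a) b = k * cinner a b" for k
  proof (transfer fixing: k)
    fix X Y :: "nat \<Rightarrow> 'a" assume "cauchy_eq X X" "cauchy_eq Y Y"
    then show "lim (\<lambda>n. cinner (k *\<^sub>C X n) (Y n)) = k * lim (\<lambda>n. cinner (X n) (Y n))"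
      unfolding cinner_scaleC_left by (intro limI tendsto_mult_left lims) simp_all
  qed
  show "inner a b = Re (cinner a b)" by (rule inner_hcompletion_def)
  show "inner a b = inner b a"
    unfolding inner_hcompletion_def by (subst com) simp
  show "inner (a + b) c = inner a c + inner b c"
    by (simp add: inner_hcompletion_def cadd)
  show "inner (r *\<^sub>R a) b = r * inner a b"
    by (simp add: inner_hcompletion_def scaleR_hcompletion_def csc)
  have self: "(\<lambda>n. (norm (X n))\<^sup>2) \<longlonglongrightarrow> Re (lim (\<lambda>n. cinner (X n) (X n)))"
    if "Cauchy X" for X :: "nat \<Rightarrow> 'a"
    using tendsto_Re[OF lims[OF that that]] by (simp add: cinner_self)
  show "0 \<le> inner a a"
    unfolding inner_hcompletion_def
  proof transfer
    fix X :: "nat \<Rightarrow> 'a" assume "cauchy_eq X X"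
    then show "0 \<le> Re (lim (\<lambda>n. cinner (X n) (X n)))"
      by (intro LIMSEQ_le_const[OF self]) auto
  qed
  show "inner a a = 0 \<longleftrightarrow> a = 0"
    unfolding inner_hcompletion_def
  proof transfer
    fix X :: "nat \<Rightarrow> 'a" assume "cauchy_eq X X"
    then have X: "Cauchy X" by simp
    have "Re (lim (\<lambda>n. cinner (X n) (X n))) = 0 \<longleftrightarrow> (\<lambda>n. (norm (X n))\<^sup>2) \<longlonglongrightarrow> 0"
      using self[OF X] LIMSEQ_unique[OF self[OF X], of 0] self[OF X]
      by (auto simp only:)
    also have "\<dots> \<longleftrightarrow> X \<longlonglongrightarrow> 0"
    proof
      assume "(\<lambda>n. (norm (X n))\<^sup>2) \<longlonglongrightarrow> 0"
      from tendsto_real_sqrt[OF this] show "X \<longlonglongrightarrow> 0"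
        by (simp add: tendsto_norm_zero_iff)
    next
      assume "X \<longlonglongrightarrow> 0"
      then show "(\<lambda>n. (norm (X n))\<^sup>2) \<longlonglongrightarrow> 0"
        using tendsto_power[of "\<lambda>n. norm (X n)" 0 sequentially 2] by (simp add: tendsto_norm_zero_iff)
    qed
    finally show "Re (lim (\<lambda>n. cinner (X n) (X n))) = 0 \<longleftrightarrow> cauchy_eq X (\<lambda>_. 0)"
      using X by (simp add: cauchy_eq_def Cauchy_const)
  qed
  show "norm a = sqrt (inner a a)" by (rule norm_hcompletion_def)
  show "sgn a = inverse (norm a) *\<^sub>R a" by (rule sgn_hcompletion_def)
  show "dist a b = norm (a - b)" by (rule dist_hcompletion_def)
  show "(uniformity :: ('a hcompletion \<times> 'a hcompletion) filter) =
      (INF e\<in>{0<..}. principal {(s, t). dist s t < e})"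
    by (rule uniformity_hcompletion_def)
  show "open U \<longleftrightarrow> (\<forall>x\<in>U. eventually (\<lambda>(x', y). x' = x \<longrightarrow> y \<in> U) uniformity)"
    for U :: "'a hcompletion set"
    by (rule open_hcompletion_def)
qed

end

lift_definition hembed :: "'a::complex_inner \<Rightarrow> 'a hcompletion" is "\<lambda>x _. x"
  by (simp add: cauchy_eq_def Cauchy_const)

lemma cinner_hembed: "cinner (hembed x) (hembed y) = cinner x y"
  by transfer simp

lemma hembed_add: "hembed (x + y) = hembed x + hembed y"
  by transfer (simp add: cauchy_eq_def Cauchy_const)

lemma hembed_scaleC: "hembed (c *\<^sub>C x) = c *\<^sub>C hembed x"
  by transfer (simp add: cauchy_eq_def Cauchy_const)

lemma hembed_diff: "hembed (x - y) = hembed x - hembed y"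
  by (metis diff_conv_add_uminus hembed_add hembed_scaleC scaleC_minus1)

lemma norm_hembed: "norm (hembed x) = norm x"
  by (simp add: norm_eq_sqrt_inner inner_eq_Re_cinner cinner_hembed)

lemma dist_hembed: "dist (hembed x) (hembed y) = dist x y"
  by (simp add: dist_norm norm_hembed flip: hembed_diff)

lemma hcompletion_limit:
  fixes X :: "nat \<Rightarrow> 'a::complex_inner"
  assumes X: "Cauchy X"
  shows "(\<lambda>n. hembed (X n)) \<longlonglongrightarrow> abs_hcompletion X"
proof (rule metric_LIMSEQ_I)
  fix e :: real assume "e > 0"
  then obtain M where M: "\<And>m n. m \<ge> M \<Longrightarrow> n \<ge> M \<Longrightarrow> norm (X m - X n) < e / 2"
    using CauchyD[OF X, of "e / 2"] by auto
  have "dist (hembed (X n)) (abs_hcompletion X) < e" if n: "n \<ge> M" for n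
  proof -
    have C: "Cauchy (\<lambda>m. X n - X m)"
      using Cauchy_plus[OF Cauchy_const[of "X n"] Cauchy_scaleC[OF X, of "-1"]]
      by (simp add: scaleC_minus1)
    have rx: "cauchy_eq Y Y" if "Cauchy Y" for Y :: "nat \<Rightarrow> 'a"
      using that by (simp add: cauchy_eq_def)
    have "abs_hcompletion (\<lambda>m. X n - X m) + abs_hcompletion X = hembed (X n)"
      by (simp add: plus_hcompletion.abs_eq[OF rx[OF C] rx[OF X]] hembed.abs_eq)
    then have eq: "hembed (X n) - abs_hcompletion X = abs_hcompletion (\<lambda>m. X n - X m)"
      by (metis add_diff_cancel_right')
    have "(norm (abs_hcompletion (\<lambda>m. X n - X m)))\<^sup>2
        = Re (lim (\<lambda>m. cinner (X n - X m) (X n - X m)))"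
      by (simp add: power2_norm_eq_inner inner_hcompletion_def cinner_hcompletion.abs_eq rx C)
    moreover have "(\<lambda>m. (norm (X n - X m))\<^sup>2) \<longlonglongrightarrow> Re (lim (\<lambda>m. cinner (X n - X m) (X n - X m)))"
      using tendsto_Re[OF Cauchy_cinner[OF C C, unfolded convergent_LIMSEQ_iff]] by (simp add: cinner_self)
    ultimately have "(\<lambda>m. (norm (X n - X m))\<^sup>2) \<longlonglongrightarrow> (norm (hembed (X n) - abs_hcompletion X))\<^sup>2"
      by (simp add: eq)
    moreover have "\<exists>N. \<forall>m\<ge>N. (norm (X n - X m))\<^sup>2 \<le> (e / 2)\<^sup>2"
      using less_imp_le[OF M[OF n]] by (intro exI[of _ M] allI impI power_mono norm_ge_zero)
    ultimately have "(norm (hembed (X n) - abs_hcompletion X))\<^sup>2 \<le> (e / 2)\<^sup>2"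
      by (rule LIMSEQ_le_const2)
    then have "norm (hembed (X n) - abs_hcompletion X) \<le> e / 2"
      by (rule power2_le_imp_le) (use \<open>e > 0\<close> in simp)
    then show ?thesis using \<open>e > 0\<close> by (simp add: dist_norm)
  qed
  then show "\<exists>N. \<forall>n\<ge>N. dist (hembed (X n)) (abs_hcompletion X) < e" by blast
qed

lemma hembed_dense: "closure (range hembed) = (UNIV :: 'a::complex_inner hcompletion set)"
proof -
  have "s \<in> closure (range hembed)" for s :: "'a hcompletion"
  proof (induction s)
    case (1 X)
    then have "(\<lambda>n. hembed (X n)) \<longlonglongrightarrow> abs_hcompletion X"
      by (intro hcompletion_limit) (simp add: cauchy_eq_def)
    then show ?case
      unfolding closure_sequential by (intro exI[of _ "\<lambda>n. hembed (X n)"]) simp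
  qed
  then show ?thesis by auto
qed

instance hcompletion :: (complex_inner) chilbert_space
proof
  fix S :: "nat \<Rightarrow> 'a hcompletion" assume S: "Cauchy S"
  have "\<exists>x. dist (hembed x) (S n) < inverse (real (Suc n))" for n
  proof -
    have "S n \<in> closure (range hembed)" by (simp add: hembed_dense)
    then have "\<exists>y\<in>range hembed. dist y (S n) < inverse (real (Suc n))"
      unfolding closure_approachable by (metis inverse_positive_iff_positive of_nat_0_less_iff zero_less_Suc)
    then show ?thesis by blast
  qed
  then obtain X where X: "\<And>n. dist (hembed (X n)) (S n) < inverse (real (Suc n))" by metis
  have 0: "(\<lambda>n. hembed (X n) - S n) \<longlonglongrightarrow> 0"
  proof (rule Lim_null_comparison[OF always_eventually LIMSEQ_inverse_real_of_nat])
    show "\<forall>n. norm (hembed (X n) - S n) \<le> inverse (real (Suc n))"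
      using X by (auto simp: dist_norm simp del: of_nat_Suc intro: less_imp_le)
  qed
  then have "Cauchy (\<lambda>n. (hembed (X n) - S n) + S n)"
    by (intro Cauchy_plus S LIMSEQ_imp_Cauchy)
  then have "Cauchy X" by (simp add: Cauchy_def dist_hembed)
  from tendsto_diff[OF hcompletion_limit[OF this] 0]
  show "convergent S" by (auto simp: convergent_def)
qed

section \<open>The Hilbert space tensor product\<close>

type_synonym ('a, 'b) htensor = "('a, 'b) atensor hcompletion"

definition tensor_vec :: "'a::chilbert_space \<Rightarrow> 'b::chilbert_space \<Rightarrow> ('a, 'b) htensor"
    (infixr \<open>\<otimes>\<^sub>v\<close> 70) where
  "x \<otimes>\<^sub>v y = hembed (atensor_of x y)"

definition tensor_op :: "('a::chilbert_space \<Rightarrow> 'a) \<Rightarrow> ('b::chilbert_space \<Rightarrow> 'b) \<Rightarrow>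
    ('a, 'b) htensor \<Rightarrow> ('a, 'b) htensor"  (infixr \<open>\<otimes>\<^sub>o\<close> 70) where
  "A \<otimes>\<^sub>o B = (THE T. bounded_clinear T \<and> (\<forall>x y. T (x \<otimes>\<^sub>v y) = A x \<otimes>\<^sub>v B y))"

lemma tensor_vec_add:
  "(x + x') \<otimes>\<^sub>v y = x \<otimes>\<^sub>v y + x' \<otimes>\<^sub>v y"
  "x \<otimes>\<^sub>v (y + y') = x \<otimes>\<^sub>v y + x \<otimes>\<^sub>v y'"
  by (simp_all add: tensor_vec_def atensor_of_add hembed_add)

lemma tensor_vec_scaleC:
  "(c *\<^sub>C x) \<otimes>\<^sub>v y = c *\<^sub>C (x \<otimes>\<^sub>v y)"
  "x \<otimes>\<^sub>v (c *\<^sub>C y) = c *\<^sub>C (x \<otimes>\<^sub>v y)"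
  by (simp_all add: tensor_vec_def atensor_of_scaleC hembed_scaleC)

lemma cinner_tensor_vec: "cinner (x \<otimes>\<^sub>v y) (z \<otimes>\<^sub>v u) = cinner x z * cinner y u"
  by (simp add: tensor_vec_def cinner_hembed cinner_atensor_of)

lemma hembed_sum_list: "hembed (\<Sum>p\<leftarrow>l. f p) = (\<Sum>p\<leftarrow>l. hembed (f p))"
proof (induction l)
  case Nil
  show ?case using hembed_add[of 0 0] by simp
qed (simp add: hembed_add)

lemma tensor_vec_dense:
  "closure (range (\<lambda>l. \<Sum>(x, y)\<leftarrow>l. x \<otimes>\<^sub>v y)) =
    (UNIV :: ('a::chilbert_space, 'b::chilbert_space) htensor set)"
proof -
  have "range hembed \<subseteq> range (\<lambda>l. \<Sum>(x, y)\<leftarrow>l. (x :: 'a) \<otimes>\<^sub>v (y :: 'b))"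
  proof
    fix s :: "('a, 'b) htensor" assume "s \<in> range hembed"
    then obtain t where "s = hembed t" by blast
    moreover obtain l where "t = (\<Sum>(x, y)\<leftarrow>l. atensor_of x y)" using atensor_sum by blast
    ultimately have "s = (\<Sum>(x, y)\<leftarrow>l. x \<otimes>\<^sub>v y)"
      by (simp add: hembed_sum_list case_prod_unfold tensor_vec_def)
    then show "s \<in> range (\<lambda>l. \<Sum>(x, y)\<leftarrow>l. x \<otimes>\<^sub>v y)" by blast
  qed
  from closure_mono[OF this] show ?thesis by (auto simp: hembed_dense)
qed

end

theory Submission
  imports Defs
begin

text \<open>
  Put \<open>T = A \<otimes> B\<close>. The inequality is the case \<open>S = T\<^sup>\<dagger>\<close> of a bound for a single operator on a
  complex inner product space. Let \<open>U = T + iS\<close> and \<open>V = T - iS\<close>, with norms \<open>u\<close> and \<open>v\<close>. Two facts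
  carry the bound.

  First, \<open>\<langle>(ST + TS)x, x\<rangle> = \<parallel>Tx\<parallel>\<^sup>2 + \<parallel>Sx\<parallel>\<^sup>2 = (\<parallel>Ux\<parallel>\<^sup>2 + \<parallel>Vx\<parallel>\<^sup>2) / 2\<close> by the parallelogram law. The
  norm of a symmetric operator is controlled by its quadratic form
  (\<open>norm_le_if_quadratic_form_le\<close>), so \<open>\<parallel>ST + TS\<parallel> \<le> (u\<^sup>2 + v\<^sup>2) / 2\<close>.

  Second, \<open>U\<close> and \<open>V\<close> are unimodular multiples of operators \<open>cT + cnj c S\<close> with \<open>\<bar>c\<bar> = 1\<close>, which are
  self-adjoint with quadratic form \<open>2 Re (c \<langle>Tx, x\<rangle>)\<close>. Hence \<open>u\<close> and \<open>v\<close> are at most \<open>2 \<bar>w(T)\<bar>\<close>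
  (\<open>norm_combination_le_numerical_radius\<close>).

  The right-hand side is therefore at most
  \<open>(u\<^sup>2 + v\<^sup>2) / 8 + \<bar>u\<^sup>2 - v\<^sup>2\<bar> / 8 = (max u v)\<^sup>2 / 4 \<le> w(T)\<^sup>2\<close>.

  To apply this, \<open>T\<^sup>\<dagger> = A\<^sup>\<dagger> \<otimes> B\<^sup>\<dagger>\<close> and \<open>(A \<otimes> B)(C \<otimes> D) = AC \<otimes> BD\<close> are needed, and beforehand that
  adjoints and tensor products of operators, which are given by definite descriptions, exist.
  Adjoints come from the Riesz representation theorem. For \<open>A \<otimes> B\<close>, the map on formal sums is
  bounded because a formal sum can be rewritten with pairwise orthogonal second components; it then
  extends to the completion. The identities are verified on elementary tensors and carried over by
  density.
\<close>

section \<open>Adjoints of bounded operators\<close>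

lemma bounded_clinearD:
  assumes "bounded_clinear T"
  shows "bounded_linear T" "T (x + y) = T x + T y" "T (c *\<^sub>C x) = c *\<^sub>C T x" "T 0 = 0"
  using assms unfolding bounded_clinear_def
  by (auto simp: linear_simps bounded_linear.linear linear_add linear_0)

lemma bounded_clinearI:
  assumes add: "\<And>x y. T (x + y) = T x + T y"
    and scale: "\<And>c x. T (c *\<^sub>C x) = c *\<^sub>C T x"
    and bound: "\<And>x. norm (T x) \<le> K * norm x"
  shows "bounded_clinear T"
  unfolding bounded_clinear_def
proof (intro conjI allI scale)
  show "bounded_linear T"
    by (rule bounded_linear_intro[of _ K])
      (simp_all add: add scale scaleR_scaleC bound[unfolded mult.commute[of K]])
qed

lemma bounded_clinear_compose:
  assumes "bounded_clinear S" "bounded_clinear T"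
  shows "bounded_clinear (S \<circ> T)"
  using assms bounded_linear_compose[of S T] by (simp add: bounded_clinear_def o_def)

lemma bounded_clinear_id: "bounded_clinear (id :: 'a::complex_inner \<Rightarrow> 'a)"
  by (rule bounded_clinearI[where K = 1]) auto

lemma cinner_eqI:
  fixes y z :: "'a::complex_inner"
  assumes "\<And>x. cinner x y = cinner x z"
  shows "y = z"
proof -
  have "cinner (y - z) (y - z) = 0"
    by (subst cinner_diff_right) (simp add: assms)
  then show ?thesis by (simp add: cinner_self)
qed

text \<open>
  Replacing \<open>x\<close> by \<open>ix\<close> recovers the imaginary part of a complex inner product from its real
  part. This turns the real Riesz theorem below into a statement on complex adjoints.
\<close>

lemma inner_eqI_cinner:
  fixes T :: "'a::complex_inner \<Rightarrow> 'b::complex_inner"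
  assumes T: "\<And>c x. T (c *\<^sub>C x) = c *\<^sub>C T x"
    and eq: "\<And>x. inner (T x) y = inner x z"
  shows "cinner (T x) y = cinner x z"
proof (rule complex_eqI)
  show "Re (cinner (T x) y) = Re (cinner x z)"
    using eq by (simp add: inner_eq_Re_cinner)
  have "Re (\<i> * cinner (T x) y) = Re (\<i> * cinner x z)"
    using eq[of "\<i> *\<^sub>C x"] by (simp add: T inner_eq_Re_cinner cinner_scaleC_left)
  then show "Im (cinner (T x) y) = Im (cinner x z)" by simp
qed

text \<open>
  The representing vector minimises the functional \<open>\<parallel>x\<parallel>\<^sup>2 - 2 f x\<close>. By the parallelogram law every
  minimising sequence is Cauchy, and the vanishing of the derivative at the minimum is the claimed
  equation.
\<close>

lemma riesz_representation:
  fixes f :: "'a::{real_inner, complete_space} \<Rightarrow> real"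
  assumes f: "bounded_linear f"
  shows "\<exists>z. \<forall>x. f x = inner x z"
proof -
  interpret f: bounded_linear f by (rule f)
  define J where "J x = (norm x)\<^sup>2 - 2 * f x" for x
  define m where "m = (INF x. J x)"
  have lower: "- (onorm f)\<^sup>2 \<le> J x" for x
  proof -
    have "f x \<le> onorm f * norm x" using onorm[OF f, of x] by simp
    moreover have "0 \<le> (norm x - onorm f)\<^sup>2" by simp
    ultimately show ?thesis by (simp add: J_def power2_diff mult_ac)
  qed
  then have bdd: "bdd_below (range J)" by (auto simp: bdd_below_def)
  have m_le: "m \<le> J x" for x unfolding m_def by (rule cINF_lower[OF bdd]) simp
  have para: "J x + J y = 2 * J ((1/2) *\<^sub>R (x + y)) + (norm (x - y))\<^sup>2 / 2" for x y
    unfolding J_def f.scaleR f.add power2_norm_eq_inner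
    by (simp add: inner_simps inner_commute field_simps)
  have "\<exists>x. J x < m + inverse (real (Suc n))" for n
    using cINF_less_iff[OF _ bdd, of "m + inverse (real (Suc n))"] by (auto simp flip: m_def)
  then obtain X where X: "\<And>n. J (X n) < m + inverse (real (Suc n))" by metis
  have "Cauchy X"
  proof (rule CauchyI)
    fix e :: real assume "0 < e"
    then obtain N where N: "inverse (real (Suc N)) < e\<^sup>2 / 4"
      using reals_Archimedean[of "e\<^sup>2 / 4"] by auto
    have "norm (X k - X n) < e" if "k \<ge> N" "n \<ge> N" for k n
    proof -
      have "inverse (real (Suc j)) \<le> inverse (real (Suc N))" if "j \<ge> N" for j
        using that by (intro le_imp_inverse_le) auto
      then have "J (X k) < m + e\<^sup>2 / 4" "J (X n) < m + e\<^sup>2 / 4"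
        using X[of k] X[of n] N that by (smt (verit))+
      then have "(norm (X k - X n))\<^sup>2 < e\<^sup>2"
        using para[of "X k" "X n"] m_le[of "(1/2) *\<^sub>R (X k + X n)"] by linarith
      then show ?thesis using \<open>0 < e\<close> by (simp add: power_less_imp_less_base)
    qed
    then show "\<exists>M. \<forall>k\<ge>M. \<forall>n\<ge>M. norm (X k - X n) < e" by blast
  qed
  then obtain z where z: "X \<longlonglongrightarrow> z" using Cauchy_convergent convergent_def by blast
  have "(\<lambda>n. J (X n)) \<longlonglongrightarrow> J z"
    unfolding J_def by (intro tendsto_intros f.tendsto z)
  moreover have "(\<lambda>n. m + inverse (real (Suc n))) \<longlonglongrightarrow> m + 0"
    by (intro tendsto_intros LIMSEQ_inverse_real_of_nat)
  ultimately have "J z \<le> m"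
    using X by (intro LIMSEQ_le[of "\<lambda>n. J (X n)" _ "\<lambda>n. m + inverse (real (Suc n))"]) (auto intro: less_imp_le)
  have "f x = inner x z" for x
  proof (rule ccontr)
    assume "f x \<noteq> inner x z"
    define d where "d = f x - inner x z"
    \<comment> \<open>A step from \<open>z\<close> along \<open>x\<close>, short enough that the first-order decrease \<open>2 t d\<close> outweighs the
      second-order increase; adding 1 to the denominator covers the case \<open>x = 0\<close>.\<close>
    define t where "t = d / ((norm x)\<^sup>2 + 1)"
    have "d \<noteq> 0" using \<open>f x \<noteq> inner x z\<close> by (simp add: d_def)
    have p: "(norm x)\<^sup>2 + 1 > 0" by (simp add: add_nonneg_pos)
    have "J (z + t *\<^sub>R x) = J z + t\<^sup>2 * (norm x)\<^sup>2 - 2 * t * d"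
      unfolding J_def f.scaleR f.add power2_norm_eq_inner d_def
      by (simp add: inner_simps inner_commute power2_eq_square algebra_simps)
    also have "\<dots> < J z"
    proof -
      have "t * ((norm x)\<^sup>2 + 1) = d" using p by (simp add: t_def)
      then have "t * d = t\<^sup>2 * (norm x)\<^sup>2 + t\<^sup>2"
        by (metis distrib_left mult.right_neutral power2_eq_square mult.assoc)
      moreover have "t\<^sup>2 > 0" using \<open>d \<noteq> 0\<close> p by (simp add: t_def)
      moreover have "t\<^sup>2 * (norm x)\<^sup>2 \<ge> 0" by simp
      moreover have "2 * t * d = 2 * (t * d)" by simp
      ultimately show ?thesis by linarith
    qed
    finally show False using m_le[of "z + t *\<^sub>R x"] \<open>J z \<le> m\<close> by linarith
  qed
  then show ?thesis by blast
qed

lemma cinner_cadjoint: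
  fixes T :: "'a::chilbert_space \<Rightarrow> 'a"
  assumes T: "bounded_clinear T"
  shows "cinner (T x) y = cinner x (T\<^sup>\<dagger> y)"
proof -
  have "\<exists>z. \<forall>x. cinner (T x) y = cinner x z" for y
  proof -
    have "bounded_linear (\<lambda>x. inner (T x) y)"
      by (rule bounded_linear_compose[OF bounded_linear_inner_left bounded_clinearD(1)[OF T]])
    from riesz_representation[OF this] obtain z where "\<And>x. inner (T x) y = inner x z" by blast
    then show ?thesis
      using inner_eqI_cinner[of T y z] bounded_clinearD(3)[OF T] by blast
  qed
  then obtain S where S: "\<forall>x y. cinner (T x) y = cinner x (S y)" by metis
  moreover have "S' = S" if "\<forall>x y. cinner (T x) y = cinner x (S' y)" for S'
  proof
    show "S' y = S y" for y
      by (rule cinner_eqI) (metis that S)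
  qed
  ultimately have "\<forall>x y. cinner (T x) y = cinner x ((T\<^sup>\<dagger>) y)"
    unfolding cadjoint_def by (rule theI)
  then show ?thesis by blast
qed

lemma bounded_clinear_cadjoint:
  fixes T :: "'a::chilbert_space \<Rightarrow> 'a"
  assumes T: "bounded_clinear T"
  shows "bounded_clinear (T\<^sup>\<dagger>)"
proof (rule bounded_clinearI)
  note adj = cinner_cadjoint[OF T, symmetric]
  fix x y :: 'a and c :: complex
  show "T\<^sup>\<dagger> (x + y) = T\<^sup>\<dagger> x + T\<^sup>\<dagger> y"
    by (rule cinner_eqI) (simp add: adj cinner_add_right)
  show "T\<^sup>\<dagger> (c *\<^sub>C x) = c *\<^sub>C T\<^sup>\<dagger> x"
    by (rule cinner_eqI) (simp add: adj cinner_scaleC_right)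
  have "(norm (T\<^sup>\<dagger> x))\<^sup>2 = cmod (cinner (T (T\<^sup>\<dagger> x)) x)"
    by (simp add: adj cinner_cadjoint[OF T] cinner_self norm_power)
  also have "\<dots> \<le> norm (T (T\<^sup>\<dagger> x)) * norm x" by (rule norm_cinner_le)
  also have "\<dots> \<le> onorm T * norm (T\<^sup>\<dagger> x) * norm x"
    by (intro mult_right_mono onorm bounded_clinearD(1)[OF T]) simp
  finally have "norm (T\<^sup>\<dagger> x) * norm (T\<^sup>\<dagger> x) \<le> norm (T\<^sup>\<dagger> x) * (onorm T * norm x)"
    by (simp add: power2_eq_square mult_ac)
  then show "norm (T\<^sup>\<dagger> x) \<le> onorm T * norm x"
    using onorm_pos_le[OF bounded_clinearD(1)[OF T]]
    by (cases "norm (T\<^sup>\<dagger> x) = 0") (simp_all add: mult_le_cancel_left)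
qed

section \<open>Operators on the tensor product\<close>

lemma tensor_eq_map_prod:
  fixes A :: "'a::complex_inner \<Rightarrow> 'c::complex_inner" and B :: "'b::complex_inner \<Rightarrow> 'd::complex_inner"
  assumes A: "bounded_clinear A" and B: "bounded_clinear B"
    and "tensor_eq l m"
  shows "tensor_eq (map (map_prod A B) l) (map (map_prod A B) m)"
  using assms(3)
proof induction
  case (sym l m)
  show ?case by (rule tensor_eq.sym[OF sym.IH])
next
  case (trans l m n)
  show ?case by (rule tensor_eq.trans[OF trans.IH])
qed (simp_all add: bounded_clinearD(2-4)[OF A] bounded_clinearD(2-4)[OF B] tensor_eq.refl
    tensor_eq.append tensor_eq.commute tensor_eq.add_left tensor_eq.add_right tensor_eq.scale
    tensor_eq.zero)

lemma list_cinner_swap: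
  "list_cinner (map prod.swap l) (map prod.swap m) = list_cinner l m"
  by (simp add: list_cinner_def case_prod_unfold o_def mult.commute)

text \<open>
  In a formal sum whose second components are pairwise orthogonal, the squared norm is
  \<open>\<Sum>\<parallel>x\<parallel>\<^sup>2\<parallel>y\<parallel>\<^sup>2\<close>. Applying \<open>A\<close> to the first components keeps the orthogonality, so the bound
  holds term by term.
\<close>

lemma list_cinner_map_left_le:
  fixes A :: "'a::complex_inner \<Rightarrow> 'c::complex_inner" and l :: "('a \<times> 'b::complex_inner) list"
  assumes A: "bounded_clinear A"
  shows "Re (list_cinner (map (map_prod A id) l) (map (map_prod A id) l))
    \<le> (onorm A)\<^sup>2 * Re (list_cinner l l)"
proof -
  obtain m where m: "tensor_eq l m" "sorted_wrt (\<lambda>u v. cinner u v = 0) (map snd m)"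
    using tensor_eq_orthogonal by blast
  define m' where "m' = map (map_prod A id) m"
  have "tensor_eq (map (map_prod A id) l) m'"
    unfolding m'_def by (rule tensor_eq_map_prod[OF A bounded_clinear_id m(1)])
  moreover have "sorted_wrt (\<lambda>u v. cinner u v = 0) (map snd m')"
    using m(2) by (simp add: m'_def o_def)
  ultimately have "Re (list_cinner (map (map_prod A id) l) (map (map_prod A id) l))
      = (\<Sum>(x, y)\<leftarrow>m'. (norm x)\<^sup>2 * (norm y)\<^sup>2)"
    using list_cinner_cong[of _ m' _ m'] list_cinner_orthogonal[of m']
    by (metis Re_complex_of_real)
  also have "\<dots> = (\<Sum>(x, y)\<leftarrow>m. (norm (A x))\<^sup>2 * (norm y)\<^sup>2)"
    by (simp add: m'_def case_prod_unfold o_def)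
  also have "\<dots> \<le> (\<Sum>(x, y)\<leftarrow>m. (onorm A)\<^sup>2 * ((norm x)\<^sup>2 * (norm y)\<^sup>2))"
  proof (rule sum_list_mono, clarify)
    fix x y
    have "(norm (A x))\<^sup>2 \<le> (onorm A * norm x)\<^sup>2"
      by (intro power_mono onorm bounded_clinearD(1)[OF A]) simp
    then show "(norm (A x))\<^sup>2 * (norm y)\<^sup>2 \<le> (onorm A)\<^sup>2 * ((norm x)\<^sup>2 * (norm y)\<^sup>2)"
      by (simp add: power_mult_distrib mult_right_mono flip: mult.assoc)
  qed
  also have "\<dots> = (onorm A)\<^sup>2 * (\<Sum>(x, y)\<leftarrow>m. (norm x)\<^sup>2 * (norm y)\<^sup>2)"
    by (simp add: case_prod_unfold sum_list_const_mult)
  also have "(\<Sum>(x, y)\<leftarrow>m. (norm x)\<^sup>2 * (norm y)\<^sup>2) = Re (list_cinner l l)"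
    using list_cinner_cong[OF m(1) m(1)] list_cinner_orthogonal[OF m(2)]
    by (metis Re_complex_of_real)
  finally show ?thesis .
qed

text \<open>
  Factor \<open>A \<otimes> B = (A \<otimes> 1)(1 \<otimes> B)\<close>; swapping the two factors reduces \<open>1 \<otimes> B\<close> to the one-sided
  bound.
\<close>

lemma list_cinner_map_prod_le:
  fixes A :: "'a::complex_inner \<Rightarrow> 'c::complex_inner" and B :: "'b::complex_inner \<Rightarrow> 'd::complex_inner"
  assumes A: "bounded_clinear A" and B: "bounded_clinear B"
  shows "Re (list_cinner (map (map_prod A B) l) (map (map_prod A B) l))
    \<le> (onorm A * onorm B)\<^sup>2 * Re (list_cinner l l)"
proof -
  define l' where "l' = map (map_prod id B) l"
  have "map (map_prod A B) l = map (map_prod A id) l'"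
    by (simp add: l'_def prod.map_comp o_def)
  then have "Re (list_cinner (map (map_prod A B) l) (map (map_prod A B) l))
      \<le> (onorm A)\<^sup>2 * Re (list_cinner l' l')"
    using list_cinner_map_left_le[OF A] by metis
  also have "Re (list_cinner l' l') \<le> (onorm B)\<^sup>2 * Re (list_cinner l l)"
  proof -
    have "map prod.swap l' = map (map_prod B id) (map prod.swap l)"
      by (simp add: l'_def prod.swap_def case_prod_unfold)
    then show ?thesis
      using list_cinner_map_left_le[OF B, of "map prod.swap l"] list_cinner_swap by metis
  qed
  finally show ?thesis
    by (simp add: power_mult_distrib mult_left_mono mult.assoc)
qed

lemma atensor_map_exists:
  fixes A :: "'a::complex_inner \<Rightarrow> 'c::complex_inner" and B :: "'b::complex_inner \<Rightarrow> 'd::complex_inner"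
  assumes A: "bounded_clinear A" and B: "bounded_clinear B"
  shows "\<exists>F. bounded_clinear F \<and> (\<forall>x y. F (atensor_of x y) = atensor_of (A x) (B y))"
proof -
  define F where "F t = abs_atensor (map (map_prod A B) (rep_atensor t))" for t
  have F: "F (abs_atensor l) = abs_atensor (map (map_prod A B) l)" for l
    unfolding F_def atensor.abs_eq_iff
    by (rule tensor_eq_map_prod[OF A B]) (simp add: atensor.abs_eq_iff[symmetric] Quotient_abs_rep[OF Quotient_atensor])
  have norm: "norm (abs_atensor l) = sqrt (Re (list_cinner l l))"
    for l :: "('e::complex_inner \<times> 'f::complex_inner) list"
    by (simp add: norm_eq_sqrt_inner inner_eq_Re_cinner cinner_atensor.abs_eq)
  have "bounded_clinear F"
  proof (rule bounded_clinearI)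
    fix s t :: "('a, 'b) atensor" and c :: complex
    show "F (s + t) = F s + F t"
      by (induction s; induction t) (simp add: F plus_atensor.abs_eq)
    show "F (c *\<^sub>C s) = c *\<^sub>C F s"
      by (induction s) (simp add: F scaleC_atensor.abs_eq list_scaleC_def case_prod_unfold
          o_def map_prod_def bounded_clinearD(3)[OF A])
    show "norm (F s) \<le> onorm A * onorm B * norm s"
    proof (induction s)
      case (1 l)
      have "sqrt (Re (list_cinner (map (map_prod A B) l) (map (map_prod A B) l)))
          \<le> sqrt ((onorm A * onorm B)\<^sup>2 * Re (list_cinner l l))"
        by (rule real_sqrt_le_mono[OF list_cinner_map_prod_le[OF A B]])
      also have "\<dots> = onorm A * onorm B * sqrt (Re (list_cinner l l))"
        using onorm_pos_le[OF bounded_clinearD(1)[OF A]] onorm_pos_le[OF bounded_clinearD(1)[OF B]]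
        by (simp add: real_sqrt_mult)
      finally show ?case by (simp add: F norm)
    qed
  qed
  moreover have "F (atensor_of x y) = atensor_of (A x) (B y)" for x y
    by (simp add: atensor_of.abs_eq F)
  ultimately show ?thesis by blast
qed

text \<open>
  The extension is the limit of \<open>F\<close> along any approximating sequence. Boundedness of \<open>F\<close> makes the
  limit exist and independent of the sequence, so additivity, homogeneity and the norm bound pass
  to the limit.
\<close>

lemma hcompletion_map_exists:
  fixes F :: "'a::complex_inner \<Rightarrow> 'b::complex_inner"
  assumes F: "bounded_clinear F"
  shows "\<exists>G. bounded_clinear G \<and> (\<forall>x. G (hembed x) = hembed (F x))"
proof -
  interpret F: bounded_linear F by (rule bounded_clinearD(1)[OF F])
  have approx: "\<exists>X. (\<lambda>n. hembed (X n)) \<longlonglongrightarrow> s" for s :: "'a hcompletion"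
  proof (induction s)
    case (1 X)
    then show ?case using hcompletion_limit[of X] by (auto simp: cauchy_eq_def)
  qed
  have conv: "convergent (\<lambda>n. hembed (F (X n)))" if "(\<lambda>n. hembed (X n)) \<longlonglongrightarrow> s" for X s
  proof -
    have "Cauchy X"
      using LIMSEQ_imp_Cauchy[OF that] by (simp add: Cauchy_def dist_hembed)
    then have "Cauchy (\<lambda>n. F (X n))" by (rule F.Cauchy)
    then show ?thesis using hcompletion_limit convergentI by blast
  qed
  define R where "R s = (SOME X. (\<lambda>n. hembed (X n)) \<longlonglongrightarrow> s)" for s :: "'a hcompletion"
  have R: "(\<lambda>n. hembed (R s n)) \<longlonglongrightarrow> s" for s
    unfolding R_def by (rule someI_ex[OF approx])
  define G where "G s = lim (\<lambda>n. hembed (F (R s n)))" for s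
  have G: "(\<lambda>n. hembed (F (X n))) \<longlonglongrightarrow> G s" if X: "(\<lambda>n. hembed (X n)) \<longlonglongrightarrow> s" for X s
  proof -
    have "(\<lambda>n. hembed (X n - R s n)) \<longlonglongrightarrow> 0"
      using tendsto_diff[OF X R[of s]] by (simp add: hembed_diff)
    then have "(\<lambda>n. X n - R s n) \<longlonglongrightarrow> 0"
      by (subst (asm) tendsto_norm_zero_iff[symmetric], subst tendsto_norm_zero_iff[symmetric])
        (simp add: norm_hembed)
    from F.tendsto[OF this] have "(\<lambda>n. F (X n - R s n)) \<longlonglongrightarrow> 0" by (simp add: F.zero)
    then have "(\<lambda>n. hembed (F (X n - R s n))) \<longlonglongrightarrow> 0"
      by (subst (asm) tendsto_norm_zero_iff[symmetric], subst tendsto_norm_zero_iff[symmetric])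
        (simp add: norm_hembed)
    moreover have "(\<lambda>n. hembed (F (R s n))) \<longlonglongrightarrow> G s"
      using conv[OF R[of s]] unfolding G_def convergent_LIMSEQ_iff .
    ultimately have "(\<lambda>n. hembed (F (X n - R s n)) + hembed (F (R s n))) \<longlonglongrightarrow> 0 + G s"
      by (rule tendsto_add)
    then show ?thesis by (simp add: F.diff hembed_diff)
  qed
  have "bounded_clinear G"
  proof (rule bounded_clinearI)
    fix s t :: "'a hcompletion" and c :: complex
    have "(\<lambda>n. hembed (R s n + R t n)) \<longlonglongrightarrow> s + t"
      unfolding hembed_add by (intro tendsto_add R)
    from G[OF this] have "(\<lambda>n. hembed (F (R s n)) + hembed (F (R t n))) \<longlonglongrightarrow> G (s + t)"
      by (simp add: F.add hembed_add)
    then show "G (s + t) = G s + G t"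
      by (rule LIMSEQ_unique) (intro tendsto_add G R)
    have "(\<lambda>n. hembed (c *\<^sub>C R s n)) \<longlonglongrightarrow> c *\<^sub>C s"
      unfolding hembed_scaleC by (intro bounded_linear.tendsto[OF bounded_linear_scaleC] R)
    from G[OF this] have "(\<lambda>n. c *\<^sub>C hembed (F (R s n))) \<longlonglongrightarrow> G (c *\<^sub>C s)"
      by (simp add: bounded_clinearD(3)[OF F] hembed_scaleC)
    then show "G (c *\<^sub>C s) = c *\<^sub>C G s"
      by (rule LIMSEQ_unique) (intro bounded_linear.tendsto[OF bounded_linear_scaleC] G R)
    have "(\<lambda>n. norm (hembed (F (R s n)))) \<longlonglongrightarrow> norm (G s)"
      by (intro tendsto_norm G R)
    moreover have "(\<lambda>n. onorm F * norm (hembed (R s n))) \<longlonglongrightarrow> onorm F * norm s"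
      by (intro tendsto_intros R)
    moreover have "norm (hembed (F (R s n))) \<le> onorm F * norm (hembed (R s n))" for n
      unfolding norm_hembed by (rule onorm[OF F.bounded_linear_axioms])
    ultimately show "norm (G s) \<le> onorm F * norm s"
      by (intro LIMSEQ_le[of "\<lambda>n. norm (hembed (F (R s n)))"]) auto
  qed
  moreover have "G (hembed x) = hembed (F x)" for x
    using G[of "\<lambda>_. x" "hembed x"] LIMSEQ_unique tendsto_const by blast
  ultimately show ?thesis by blast
qed

text \<open>
  Density of the sums of elementary tensors as an induction principle. Closure under
  addition suffices, since coefficients are absorbed into the first factors.
\<close>

lemma htensor_induct:
  fixes s :: "('a::chilbert_space, 'b::chilbert_space) htensor"
  assumes closed: "closed {s. P s}"
    and tensor: "\<And>x y. P (x \<otimes>\<^sub>v y)"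
    and add: "\<And>s t. P s \<Longrightarrow> P t \<Longrightarrow> P (s + t)"
  shows "P s"
proof -
  have zero: "P 0"
    using tensor[of 0 0] tensor_vec_scaleC(1)[of 0 "0::'a" "0::'b"] by (simp add: scaleC_zero_left)
  have "P (\<Sum>(x, y)\<leftarrow>l. x \<otimes>\<^sub>v y)" for l
    by (induction l) (auto simp: zero tensor add)
  then have "closure (range (\<lambda>l. \<Sum>(x, y)\<leftarrow>l. (x :: 'a) \<otimes>\<^sub>v (y :: 'b))) \<subseteq> {s. P s}"
    by (intro closure_minimal closed) blast
  then show ?thesis unfolding tensor_vec_dense by blast
qed

lemma bounded_clinear_htensor_eqI:
  fixes S T :: "('a::chilbert_space, 'b::chilbert_space) htensor \<Rightarrow> 'c::complex_inner"
  assumes S: "bounded_clinear S" and T: "bounded_clinear T"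
    and eq: "\<And>x y. S (x \<otimes>\<^sub>v y) = T (x \<otimes>\<^sub>v y)"
  shows "S = T"
proof
  fix s
  show "S s = T s"
  proof (rule htensor_induct[where P = "\<lambda>s. S s = T s"])
    show "closed {s. S s = T s}"
      by (intro closed_Collect_eq linear_continuous_on bounded_clinearD(1) S T)
  qed (simp_all add: eq bounded_clinearD(2)[OF S] bounded_clinearD(2)[OF T])
qed

lemma tensor_op_props:
  fixes A :: "'a::chilbert_space \<Rightarrow> 'a" and B :: "'b::chilbert_space \<Rightarrow> 'b"
  assumes A: "bounded_clinear A" and B: "bounded_clinear B"
  shows bounded_clinear_tensor_op: "bounded_clinear (A \<otimes>\<^sub>o B)"
    and tensor_op_tensor_vec: "(A \<otimes>\<^sub>o B) (x \<otimes>\<^sub>v y) = A x \<otimes>\<^sub>v B y"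
proof -
  obtain F where F: "bounded_clinear F" "\<And>x y. F (atensor_of x y) = atensor_of (A x) (B y)"
    using atensor_map_exists[OF A B] by blast
  obtain G where G: "bounded_clinear G" "\<And>x. G (hembed x) = hembed (F x)"
    using hcompletion_map_exists[OF F(1)] by blast
  have G': "bounded_clinear G \<and> (\<forall>x y. G (x \<otimes>\<^sub>v y) = A x \<otimes>\<^sub>v B y)"
    by (simp add: tensor_vec_def G F)
  moreover have "T = G" if "bounded_clinear T \<and> (\<forall>x y. T (x \<otimes>\<^sub>v y) = A x \<otimes>\<^sub>v B y)" for T
    using that G' by (intro bounded_clinear_htensor_eqI) auto
  ultimately have "bounded_clinear (A \<otimes>\<^sub>o B) \<and> (\<forall>x y. (A \<otimes>\<^sub>o B) (x \<otimes>\<^sub>v y) = A x \<otimes>\<^sub>v B y)"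
    unfolding tensor_op_def by (rule theI)
  then show "bounded_clinear (A \<otimes>\<^sub>o B)" "(A \<otimes>\<^sub>o B) (x \<otimes>\<^sub>v y) = A x \<otimes>\<^sub>v B y" by auto
qed

lemma tensor_op_compose:
  fixes A C :: "'a::chilbert_space \<Rightarrow> 'a" and B D :: "'b::chilbert_space \<Rightarrow> 'b"
  assumes A: "bounded_clinear A" and B: "bounded_clinear B"
    and C: "bounded_clinear C" and D: "bounded_clinear D"
  shows "(A \<circ> C) \<otimes>\<^sub>o (B \<circ> D) = (A \<otimes>\<^sub>o B) \<circ> (C \<otimes>\<^sub>o D)"
  by (rule bounded_clinear_htensor_eqI)
    (simp_all add: assms bounded_clinear_compose bounded_clinear_tensor_op tensor_op_tensor_vec)

lemma cinner_tensor_op: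
  fixes A :: "'a::chilbert_space \<Rightarrow> 'a" and B :: "'b::chilbert_space \<Rightarrow> 'b"
  assumes A: "bounded_clinear A" and B: "bounded_clinear B"
  shows "cinner ((A \<otimes>\<^sub>o B) s) t = cinner s ((A\<^sup>\<dagger> \<otimes>\<^sub>o B\<^sup>\<dagger>) t)"
proof -
  note A' = bounded_clinear_cadjoint[OF A] and B' = bounded_clinear_cadjoint[OF B]
  note T = bounded_clinear_tensor_op[OF A B] and S = bounded_clinear_tensor_op[OF A' B']
  note cont = bounded_bilinear.continuous_on[OF bounded_bilinear_cinner]
    linear_continuous_on[OF bounded_clinearD(1)[OF T]] linear_continuous_on[OF bounded_clinearD(1)[OF S]]
    continuous_on_const continuous_on_id
  show ?thesis
  proof (rule htensor_induct[where s = s])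
    show "closed {s. cinner ((A \<otimes>\<^sub>o B) s) t = cinner s ((A\<^sup>\<dagger> \<otimes>\<^sub>o B\<^sup>\<dagger>) t)}"
      by (intro closed_Collect_eq cont)
    show "cinner ((A \<otimes>\<^sub>o B) (x \<otimes>\<^sub>v y)) t = cinner (x \<otimes>\<^sub>v y) ((A\<^sup>\<dagger> \<otimes>\<^sub>o B\<^sup>\<dagger>) t)" for x y
    proof (rule htensor_induct[where s = t])
      show "closed {t. cinner ((A \<otimes>\<^sub>o B) (x \<otimes>\<^sub>v y)) t = cinner (x \<otimes>\<^sub>v y) ((A\<^sup>\<dagger> \<otimes>\<^sub>o B\<^sup>\<dagger>) t)}"
        by (intro closed_Collect_eq cont)
    qed (simp_all add: tensor_op_tensor_vec[OF A B] tensor_op_tensor_vec[OF A' B'] cinner_tensor_vec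
        cinner_cadjoint[OF A] cinner_cadjoint[OF B] bounded_clinearD(2)[OF S] cinner_add_right)
  qed (simp_all add: bounded_clinearD(2)[OF T] cinner_add_left)
qed

section \<open>The numerical radius inequality\<close>

text \<open>
  The absolute value makes the constant nonnegative, as a bound for an operator norm has to be, also
  on the zero space, where \<open>numerical_radius T\<close> is an unspecified real number.
\<close>

lemma cmod_cinner_le_numerical_radius:
  fixes T :: "'a::complex_inner \<Rightarrow> 'a"
  assumes T: "bounded_clinear T"
  shows "cmod (cinner (T x) x) \<le> \<bar>numerical_radius T\<bar> * (norm x)\<^sup>2"
proof (cases "x = 0")
  case False
  define u where "u = complex_of_real (inverse (norm x)) *\<^sub>C x"
  have u: "norm u = 1" using False by (simp add: u_def norm_scaleC norm_inverse)
  have "bdd_above ((\<lambda>x. cmod (cinner (T x) x)) ` {x. norm x = 1})"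
  proof (rule bdd_aboveI2)
    fix y :: 'a assume "y \<in> {y. norm y = 1}"
    then show "cmod (cinner (T y) y) \<le> onorm T"
      using norm_cinner_le[of "T y" y] onorm[OF bounded_clinearD(1)[OF T], of y] by simp
  qed
  then have "cmod (cinner (T u) u) \<le> numerical_radius T"
    unfolding numerical_radius_def using u by (intro cSUP_upper) auto
  moreover have "cmod (cinner (T u) u) = cmod (cinner (T x) x) / (norm x)\<^sup>2"
    by (simp add: u_def bounded_clinearD(3)[OF T] cinner_scaleC_left cinner_scaleC_right
        norm_mult norm_inverse power2_eq_square divide_inverse)
  ultimately have "cmod (cinner (T x) x) / (norm x)\<^sup>2 \<le> \<bar>numerical_radius T\<bar>" by linarith
  then show ?thesis using False by (simp add: pos_divide_le_eq)
qed (simp add: cinner_zero_right)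

text \<open>
  Polarisation bounds \<open>inner (L x) y\<close> by \<open>c (\<parallel>x\<parallel>\<^sup>2 + \<parallel>y\<parallel>\<^sup>2) / 2\<close>; then take \<open>y\<close> in the direction of
  \<open>L x\<close> with the length of \<open>x\<close>.
\<close>

lemma norm_le_if_quadratic_form_le:
  fixes L :: "'a::real_inner \<Rightarrow> 'a"
  assumes L: "linear L" and sym: "\<And>x y. inner (L x) y = inner x (L y)"
    and bound: "\<And>x. \<bar>inner (L x) x\<bar> \<le> c * (norm x)\<^sup>2"
  shows "norm (L x) \<le> c * norm x"
proof (cases "L x = 0")
  case True
  then show ?thesis
  proof (cases "x = 0")
    case False
    have "0 \<le> c * (norm x)\<^sup>2" using bound[of x] by linarith
    then have "0 \<le> c" using False by (simp add: zero_le_mult_iff)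
    then show ?thesis using True by simp
  qed simp
next
  case False
  have polar: "4 * inner (L x) y \<le> 2 * c * ((norm x)\<^sup>2 + (norm y)\<^sup>2)" for y
  proof -
    have "4 * inner (L x) y = inner (L (x + y)) (x + y) - inner (L (x - y)) (x - y)"
      using sym[of y x]
      by (simp add: linear_add[OF L] linear_diff[OF L] inner_simps inner_commute)
    also have "\<dots> \<le> c * (norm (x + y))\<^sup>2 + c * (norm (x - y))\<^sup>2"
      using bound[of "x + y"] bound[of "x - y"] by linarith
    also have "\<dots> = 2 * c * ((norm x)\<^sup>2 + (norm y)\<^sup>2)"
      by (simp add: power2_norm_eq_inner inner_simps inner_commute algebra_simps)
    finally show ?thesis .
  qed
  have "x \<noteq> 0" using False linear_0[OF L] by auto
  define y where "y = (norm x / norm (L x)) *\<^sub>R L x"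
  have "norm y = norm x" using False by (simp add: y_def)
  moreover have "inner (L x) y = norm x * norm (L x)"
    using False by (simp add: y_def power2_eq_square flip: power2_norm_eq_inner)
  ultimately have "norm x * norm (L x) \<le> norm x * (c * norm x)"
    using polar[of y] by (simp add: power2_eq_square mult_ac)
  then show ?thesis using \<open>x \<noteq> 0\<close> by simp
qed

text \<open>
  Here \<open>S\<close> is the adjoint of \<open>T\<close>. With \<open>\<mu>\<^sup>2 = ab\<close> and \<open>c = cnj \<mu> a\<close>, one has \<open>aT + bS = \<mu> (cT + cnj c S)\<close>:
  a unimodular multiple of a self-adjoint operator whose quadratic form is at most \<open>2 \<bar>\<langle>Tx, x\<rangle>\<bar>\<close> in absolute value.
\<close>

lemma norm_combination_le_numerical_radius:
  fixes T S :: "'a::complex_inner \<Rightarrow> 'a"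
  assumes T: "bounded_clinear T" and S: "bounded_clinear S"
    and adj: "\<And>x y. cinner (T x) y = cinner x (S y)"
    and a: "cmod a = 1" and b: "cmod b = 1"
  shows "norm (a *\<^sub>C T x + b *\<^sub>C S x) \<le> 2 * \<bar>numerical_radius T\<bar> * norm x"
proof -
  define \<mu> where "\<mu> = csqrt (a * b)"
  define c where "c = cnj \<mu> * a"
  have "cmod \<mu> = 1" using a b by (simp add: \<mu>_def norm_mult)
  then have c1: "cmod c = 1" using a by (simp add: c_def norm_mult)
  have unit: "z * cnj z = 1" if "cmod z = 1" for z
    using that by (metis complex_norm_square of_real_1 power_one)
  have ac: "a = \<mu> * c"
    using unit[OF \<open>cmod \<mu> = 1\<close>] by (simp add: c_def flip: mult.assoc)
  have "\<mu> * cnj c = \<mu>\<^sup>2 * cnj a" by (simp add: c_def power2_eq_square)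
  also have "\<mu>\<^sup>2 = a * b" by (simp add: \<mu>_def)
  finally have bc: "b = \<mu> * cnj c" using unit[OF a] by (simp add: mult_ac)
  define L where "L z = c *\<^sub>C T z + cnj c *\<^sub>C S z" for z
  have adj': "cinner (S x) y = cinner x (T y)" for x y
    by (metis adj cinner_commute)
  have sym: "cinner (L x) y = cinner x (L y)" for x y
    by (simp add: L_def cinner_add_left cinner_add_right cinner_scaleC_left cinner_scaleC_right
        adj adj')
  have "linear L"
    by (rule linearI) (simp_all add: L_def bounded_clinearD(2,3)[OF T] bounded_clinearD(2,3)[OF S]
        scaleC_add_right scaleR_scaleC scaleC_scaleC mult.commute)
  moreover have "inner (L x) y = inner x (L y)" for x y
    by (simp add: inner_eq_Re_cinner sym)
  moreover have "\<bar>inner (L x) x\<bar> \<le> 2 * \<bar>numerical_radius T\<bar> * (norm x)\<^sup>2" for x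
  proof -
    have "\<bar>inner (L x) x\<bar> \<le> cmod (cinner (L x) x)"
      by (simp add: inner_eq_Re_cinner abs_Re_le_cmod)
    also have "\<dots> \<le> cmod (c * cinner (T x) x) + cmod (cnj c * cinner (S x) x)"
      by (simp add: L_def cinner_add_left cinner_scaleC_left norm_triangle_ineq)
    also have "\<dots> = 2 * cmod (cinner (T x) x)"
      using c1 adj[of x x] cinner_commute[of "S x" x] by (simp add: norm_mult)
    finally show ?thesis using cmod_cinner_le_numerical_radius[OF T, of x] by linarith
  qed
  ultimately have "norm (L x) \<le> 2 * \<bar>numerical_radius T\<bar> * norm x"
    by (rule norm_le_if_quadratic_form_le)
  moreover have "a *\<^sub>C T x + b *\<^sub>C S x = \<mu> *\<^sub>C L x"
    by (simp add: L_def ac bc scaleC_add_right scaleC_scaleC)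
  ultimately show ?thesis using \<open>cmod \<mu> = 1\<close> by (simp add: norm_scaleC)
qed

lemma numerical_radius_lower_bound:
  fixes T S :: "'a::complex_inner \<Rightarrow> 'a"
  assumes T: "bounded_clinear T" and S: "bounded_clinear S"
    and adj: "\<And>x y. cinner (T x) y = cinner x (S y)"
  shows "onorm (\<lambda>z. S (T z) + T (S z)) / 4
    + \<bar>(onorm (\<lambda>z. T z + \<i> *\<^sub>C S z))\<^sup>2 - (onorm (\<lambda>z. T z - \<i> *\<^sub>C S z))\<^sup>2\<bar> / 8
    \<le> (numerical_radius T)\<^sup>2"
proof -
  define U where "U z = T z + \<i> *\<^sub>C S z" for z
  define V where "V z = T z - \<i> *\<^sub>C S z" for z
  define P where "P z = S (T z) + T (S z)" for z
  define u where "u = onorm U"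
  define v where "v = onorm V"
  note T' = bounded_clinearD(1)[OF T] and S' = bounded_clinearD(1)[OF S]
  have bl: "bounded_linear U" "bounded_linear V" "bounded_linear P"
    unfolding U_def V_def P_def
    by (intro bounded_linear_add bounded_linear_sub T'
        bounded_linear_compose[OF bounded_linear_scaleC S'] bounded_linear_compose[OF S' T']
        bounded_linear_compose[OF T' S'])+
  have adj': "cinner (S x) y = cinner x (T y)" for x y
    by (metis adj cinner_commute)
  have iadj: "inner (T x) y = inner x (S y)" "inner (S x) y = inner x (T y)" for x y
    by (simp_all add: inner_eq_Re_cinner adj adj')
  have "\<bar>inner (P x) x\<bar> \<le> (u\<^sup>2 + v\<^sup>2) / 2 * (norm x)\<^sup>2" for x
  proof -
    have sq: "inner (P x) x = (norm (T x))\<^sup>2 + (norm (S x))\<^sup>2"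
      by (simp add: P_def inner_simps iadj power2_norm_eq_inner)
    also have "\<dots> = ((norm (U x))\<^sup>2 + (norm (V x))\<^sup>2) / 2"
    proof -
      have "norm (S x) = norm (\<i> *\<^sub>C S x)" by (simp add: norm_scaleC)
      then show ?thesis
        unfolding U_def V_def power2_norm_eq_inner[of "T x + _"] power2_norm_eq_inner[of "T x - _"]
        by (simp add: inner_simps power2_norm_eq_inner inner_commute)
    qed
    also have "\<dots> \<le> ((u * norm x)\<^sup>2 + (v * norm x)\<^sup>2) / 2"
      unfolding u_def v_def
      by (intro divide_right_mono add_mono power_mono onorm bl norm_ge_zero) simp
    also have "\<dots> = (u\<^sup>2 + v\<^sup>2) / 2 * (norm x)\<^sup>2"
      by (simp add: power_mult_distrib algebra_simps)
    finally have "inner (P x) x \<le> (u\<^sup>2 + v\<^sup>2) / 2 * (norm x)\<^sup>2" .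
    moreover have "0 \<le> inner (P x) x"
      by (simp add: sq)
    ultimately show ?thesis by simp
  qed
  moreover have "inner (P x) y = inner x (P y)" for x y
    by (simp add: P_def inner_simps iadj)
  ultimately have "norm (P x) \<le> (u\<^sup>2 + v\<^sup>2) / 2 * norm x" for x
    using norm_le_if_quadratic_form_le[OF bounded_linear.linear[OF bl(3)]] by blast
  then have P: "onorm P \<le> (u\<^sup>2 + v\<^sup>2) / 2"
    by (intro onorm_bound) simp_all
  define w where "w = \<bar>numerical_radius T\<bar>"
  have "norm (U x) \<le> 2 * w * norm x" "norm (V x) \<le> 2 * w * norm x" for x
    using norm_combination_le_numerical_radius[OF T S adj, of 1 \<i> x]
      norm_combination_le_numerical_radius[OF T S adj, of 1 "- \<i>" x]
    by (simp_all add: U_def V_def w_def scaleC_one)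
       (metis diff_conv_add_uminus scaleC_minus1 scaleC_scaleC mult_minus1)
  then have "u \<le> 2 * w" "v \<le> 2 * w"
    unfolding u_def v_def by (auto intro!: onorm_bound simp: w_def)
  moreover have "0 \<le> u" "0 \<le> v" unfolding u_def v_def by (intro onorm_pos_le bl)+
  ultimately have "u\<^sup>2 \<le> (2 * w)\<^sup>2" "v\<^sup>2 \<le> (2 * w)\<^sup>2" by - (rule power_mono; assumption)+
  then have "onorm P / 4 + \<bar>u\<^sup>2 - v\<^sup>2\<bar> / 8 \<le> w\<^sup>2"
    using P by (auto simp: power_mult_distrib abs_if field_simps)
  then show ?thesis
    by (simp add: u_def v_def w_def U_def[abs_def] V_def[abs_def] P_def[abs_def])
qed

theorem theorem2p15:
  fixes A :: "'a::chilbert_space \<Rightarrow> 'a" and B :: "'b::chilbert_space \<Rightarrow> 'b"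
  assumes "bounded_clinear A" and "bounded_clinear B"
  shows "(numerical_radius (A \<otimes>\<^sub>o B))\<^sup>2 \<ge>
    onorm (\<lambda>z. ((A\<^sup>\<dagger> \<circ> A) \<otimes>\<^sub>o (B\<^sup>\<dagger> \<circ> B)) z + ((A \<circ> A\<^sup>\<dagger>) \<otimes>\<^sub>o (B \<circ> B\<^sup>\<dagger>)) z) / 4
    + \<bar>(onorm (\<lambda>z. (A \<otimes>\<^sub>o B) z + \<i> *\<^sub>C (A\<^sup>\<dagger> \<otimes>\<^sub>o B\<^sup>\<dagger>) z))\<^sup>2
       - (onorm (\<lambda>z. (A \<otimes>\<^sub>o B) z - \<i> *\<^sub>C (A\<^sup>\<dagger> \<otimes>\<^sub>o B\<^sup>\<dagger>) z))\<^sup>2\<bar> / 8"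
proof -
  note A' = bounded_clinear_cadjoint[OF assms(1)] and B' = bounded_clinear_cadjoint[OF assms(2)]
  show ?thesis
    using numerical_radius_lower_bound[OF bounded_clinear_tensor_op[OF assms]
        bounded_clinear_tensor_op[OF A' B'] cinner_tensor_op[OF assms]]
    by (simp add: tensor_op_compose assms A' B')
qed

end
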